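(* Let $0<q<1$, let $\mathcal{A}^\infty$ be the Hopf $*$-algebra of $SU_q(2)$, and let $\tau_{\rm ev}:\mathcal{A}^\infty\to\mathbb{C}$ be the trace with $\tau_{\rm ev}(1)=1$ whose class $[\tau_{\rm ev}]\in HC^0(\mathcal{A}^\infty)$ is the Chern character of a generator of the even K-homology group $K^0(\mathcal{A}^\infty)\cong\mathbb{Z}$. Then the class $[\tau_{\rm ev}]$ is not invariant.
   Context: $\mathcal{A}^\infty$ is the unital $*$-algebra generated by $\alpha,\beta$ with relations $\alpha^*\alpha+\beta^*\beta=1$, $\alpha\alpha^*+q^2\beta\beta^*=1$, $\alpha\beta=q\beta\alpha$, $\alpha\beta^*=q\beta^*\alpha$, $\beta^*\beta=\beta\beta^*$. Its coproduct is the $*$-homomorphism $\Delta$ with $\Delta(\alpha)=\alpha\otimes\alpha-q\beta^*\otimes\beta$, $\Delta(\beta)=\beta\otimes\alpha+\alpha^*\otimes\beta$. Sweedler notation: $\Delta(a)=a^{(1)}\otimes a^{(2)}$ (summation implied). For an $m$-linear functional $\phi$ on $\mathcal{A}^\infty$ (viewed as a linear functional on the $m$-fold algebraic tensor product) and a linear functional $\psi:\mathcal{A}^\infty\to\mathbb{C}$, the convolution is $$(\phi*\psi)(a_1\otimes\cdots\otimes a_m)=\phi(a_1^{(1)}\otimes\cdots\otimes a_m^{(1)})\,\psi(a_1^{(2)}\cdots a_m^{(2)}).$$ An $m$-linear functional $\phi$ is called invariant if $\phi*\psi=\psi(1)\phi$ for every linear functional $\psi$ on $\mathcal{A}^\infty$.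 $HC^n(\mathcal{A}^\infty)$ denotes the (algebraic) cyclic cohomology; its elements are classes of cyclic cocycles, which are $(n+1)$-linear functionals. $HC^0(\mathcal{A}^\infty)$ is the space of traces, i.e. linear functionals $\tau$ with $\tau(ab)=\tau(ba)$. A class $[\phi]\in HC^n(\mathcal{A}^\infty)$ is called invariant if there is an invariant $(n+1)$-linear functional $\phi'$ which is a cyclic cocycle with $[\phi']=[\phi]$. *)

theory Defs
  imports "HOL-Analysis.Analysis" "HOL-Algebra.QuotRing" "HOL-Algebra.Free_Abelian_Groups"
begin

section \<open>Complex unital star-algebras\<close>

record 'a star_alg = "'a ring" +
  cscale :: "complex \<Rightarrow> 'a \<Rightarrow> 'a"
  star :: "'a \<Rightarrow> 'a"

definition star_alg_hom ::
    "('a, 'x) star_alg_scheme \<Rightarrow> ('b, 'y) star_alg_scheme \<Rightarrow> ('a \<Rightarrow> 'b) set" where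
  "star_alg_hom A B = {f \<in> ring_hom A B.
     (\<forall>c. \<forall>x\<in>carrier A. f (cscale A c x) = cscale B c (f x)) \<and>
     (\<forall>x\<in>carrier A. f (star A x) = star B (f x))}"

definition linear_functional :: "('a, 'x) star_alg_scheme \<Rightarrow> ('a \<Rightarrow> complex) \<Rightarrow> bool" where
  "linear_functional A \<psi> \<longleftrightarrow>
     (\<forall>x\<in>carrier A. \<forall>y\<in>carrier A. \<psi> (x \<oplus>\<^bsub>A\<^esub> y) = \<psi> x + \<psi> y) \<and>
     (\<forall>c. \<forall>x\<in>carrier A. \<psi> (cscale A c x) = c * \<psi> x)"

definition trace_functional :: "('a, 'x) star_alg_scheme \<Rightarrow> ('a \<Rightarrow> complex) \<Rightarrow> bool" where
  "trace_functional A \<tau> \<longleftrightarrow> linear_functional A \<tau> \<and>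
     (\<forall>a\<in>carrier A. \<forall>b\<in>carrier A. \<tau> (a \<otimes>\<^bsub>A\<^esub> b) = \<tau> (b \<otimes>\<^bsub>A\<^esub> a))"

text \<open>The complex monoid algebra of \<open>M\<close>: finite formal combinations of elements of \<open>M\<close>.\<close>

definition monoid_algebra :: "('m, 'x) monoid_scheme \<Rightarrow> ('m \<Rightarrow>\<^sub>0 complex) ring" where
  "monoid_algebra M =
    \<lparr>carrier = {t. Poly_Mapping.keys t \<subseteq> carrier M},
     monoid.mult = (\<lambda>s t. \<Sum>k\<in>Poly_Mapping.keys s. \<Sum>l\<in>Poly_Mapping.keys t.
       Poly_Mapping.single (k \<otimes>\<^bsub>M\<^esub> l) (Poly_Mapping.lookup s k * Poly_Mapping.lookup t l)),
     monoid.one = Poly_Mapping.single \<one>\<^bsub>M\<^esub> 1,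
     ring.zero = 0,
     ring.add = (+)\<rparr>"

definition conj_extend :: "('m \<Rightarrow> 'm) \<Rightarrow> ('m \<Rightarrow>\<^sub>0 complex) \<Rightarrow> ('m \<Rightarrow>\<^sub>0 complex)" where
  "conj_extend j t =
     (\<Sum>k\<in>Poly_Mapping.keys t. Poly_Mapping.single (j k) (cnj (Poly_Mapping.lookup t k)))"

text \<open>
  The quotient of the monoid algebra of \<open>M\<close>, with the conjugate-linear involution extending the
  involution \<open>j\<close> of \<open>M\<close>, by a star-closed two-sided ideal \<open>I\<close>; its elements are cosets of \<open>I\<close>.
  Scaling by \<open>c\<close> is multiplication by the coset of \<open>c\<close> times the unit.
\<close>

definition star_quotient ::
    "('m, 'x) monoid_scheme \<Rightarrow> ('m \<Rightarrow> 'm) \<Rightarrow> ('m \<Rightarrow>\<^sub>0 complex) set \<Rightarrow> ('m \<Rightarrow>\<^sub>0 complex) set star_alg"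
  where
  "star_quotient M j I =
     ring.extend (monoid_algebra M Quot I)
       (star_alg.fields
         (\<lambda>c X. (I +>\<^bsub>monoid_algebra M\<^esub> Poly_Mapping.single \<one>\<^bsub>M\<^esub> c) \<otimes>\<^bsub>monoid_algebra M Quot I\<^esub> X)
         (\<lambda>X. conj_extend j ` X))"


section \<open>The algebraic tensor product\<close>

text \<open>
  \<open>A \<otimes> B\<close> is the space of formal combinations of pairs modulo the bilinearity relators. The linear
  span of the relators is already a two-sided ideal of the monoid algebra of \<open>A \<times> B\<close>, so it is the
  ideal generated by them.
\<close>

abbreviation formal_pair :: "'a \<Rightarrow> 'b \<Rightarrow> complex \<Rightarrow> ('a \<times> 'b \<Rightarrow>\<^sub>0 complex)" where
  "formal_pair a b c \<equiv> Poly_Mapping.single (a, b) c"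

definition bilinear_relators ::
    "('a, 'x) star_alg_scheme \<Rightarrow> ('b, 'y) star_alg_scheme \<Rightarrow> ('a \<times> 'b \<Rightarrow>\<^sub>0 complex) set" where
  "bilinear_relators A B =
     {formal_pair (x \<oplus>\<^bsub>A\<^esub> x') y 1 - formal_pair x y 1 - formal_pair x' y 1 | x x' y.
        x \<in> carrier A \<and> x' \<in> carrier A \<and> y \<in> carrier B} \<union>
     {formal_pair x (y \<oplus>\<^bsub>B\<^esub> y') 1 - formal_pair x y 1 - formal_pair x y' 1 | x y y'.
        x \<in> carrier A \<and> y \<in> carrier B \<and> y' \<in> carrier B} \<union>
     {formal_pair (cscale A c x) y 1 - formal_pair x y c | c x y.
        x \<in> carrier A \<and> y \<in> carrier B} \<union>
     {formal_pair x (cscale B c y) 1 - formal_pair x y c | c x y.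
        x \<in> carrier A \<and> y \<in> carrier B}"

definition tensor_ideal ::
    "('a, 'x) star_alg_scheme \<Rightarrow> ('b, 'y) star_alg_scheme \<Rightarrow> ('a \<times> 'b \<Rightarrow>\<^sub>0 complex) set" where
  "tensor_ideal A B = genideal (monoid_algebra (A \<times>\<times> B)) (bilinear_relators A B)"

definition tensor_alg ::
    "('a, 'x) star_alg_scheme \<Rightarrow> ('b, 'y) star_alg_scheme \<Rightarrow> ('a \<times> 'b \<Rightarrow>\<^sub>0 complex) set star_alg"
  where
  "tensor_alg A B = star_quotient (A \<times>\<times> B) (map_prod (star A) (star B)) (tensor_ideal A B)"

definition pure_tensor ::
    "('a, 'x) star_alg_scheme \<Rightarrow> ('b, 'y) star_alg_scheme \<Rightarrow> 'a \<Rightarrow> 'b \<Rightarrow> ('a \<times> 'b \<Rightarrow>\<^sub>0 complex) set"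
  where
  "pure_tensor A B x y = tensor_ideal A B +>\<^bsub>monoid_algebra (A \<times>\<times> B)\<^esub> formal_pair x y 1"


section \<open>The star-algebra of \<open>SU\<^sub>q(2)\<close>\<close>

text \<open>Words in the letters \<open>\<alpha>\<close>, \<open>\<beta>\<close>, \<open>\<alpha>\<^sup>*\<close>, \<open>\<beta>\<^sup>*\<close>; their monoid algebra is the free unital star-algebra
  on \<open>\<alpha>\<close> and \<open>\<beta>\<close>.\<close>

datatype letter = La | Lb | Las | Lbs

fun letter_star :: "letter \<Rightarrow> letter" where
  "letter_star La = Las"
| "letter_star Las = La"
| "letter_star Lb = Lbs"
| "letter_star Lbs = Lb"

definition word_monoid :: "letter list monoid" where
  "word_monoid = \<lparr>carrier = UNIV, monoid.mult = (@), monoid.one = []\<rparr>"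

definition word_star :: "letter list \<Rightarrow> letter list" where
  "word_star w = rev (map letter_star w)"

abbreviation free_word :: "letter list \<Rightarrow> complex \<Rightarrow> (letter list \<Rightarrow>\<^sub>0 complex)" where
  "free_word w c \<equiv> Poly_Mapping.single w c"

definition SUq2_relators :: "real \<Rightarrow> (letter list \<Rightarrow>\<^sub>0 complex) set" where
  "SUq2_relators q =
    {free_word [Las, La] 1 + free_word [Lbs, Lb] 1 - free_word [] 1,
     free_word [La, Las] 1 + free_word [Lb, Lbs] (of_real (q\<^sup>2)) - free_word [] 1,
     free_word [La, Lb] 1 - free_word [Lb, La] (of_real q),
     free_word [La, Lbs] 1 - free_word [Lbs, La] (of_real q),
     free_word [Lbs, Lb] 1 - free_word [Lb, Lbs] 1}"

definition SUq2_ideal :: "real \<Rightarrow> (letter list \<Rightarrow>\<^sub>0 complex) set" where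
  "SUq2_ideal q = genideal (monoid_algebra word_monoid)
     (SUq2_relators q \<union> conj_extend word_star ` SUq2_relators q)"

type_synonym suq2 = "(letter list \<Rightarrow>\<^sub>0 complex) set"

definition SUq2 :: "real \<Rightarrow> suq2 star_alg" where
  "SUq2 q = star_quotient word_monoid word_star (SUq2_ideal q)"

definition suq2_alpha :: "real \<Rightarrow> suq2" where
  "suq2_alpha q = SUq2_ideal q +>\<^bsub>monoid_algebra word_monoid\<^esub> free_word [La] 1"

definition suq2_beta :: "real \<Rightarrow> suq2" where
  "suq2_beta q = SUq2_ideal q +>\<^bsub>monoid_algebra word_monoid\<^esub> free_word [Lb] 1"

text \<open>The conditions below determine \<open>\<Delta>\<close> on the carrier, since \<open>\<alpha>\<close> and \<open>\<beta>\<close> generate.\<close>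

definition is_SUq2_coproduct :: "real \<Rightarrow> (suq2 \<Rightarrow> (suq2 \<times> suq2 \<Rightarrow>\<^sub>0 complex) set) \<Rightarrow> bool" where
  "is_SUq2_coproduct q \<Delta> \<longleftrightarrow>
    (let A = SUq2 q; T = tensor_alg A A; tens = pure_tensor A A;
         \<alpha> = suq2_alpha q; \<beta> = suq2_beta q
     in \<Delta> \<in> star_alg_hom A T \<and>
        \<Delta> \<alpha> = tens \<alpha> \<alpha> \<ominus>\<^bsub>T\<^esub> cscale T (of_real q) (tens (star A \<beta>) \<beta>) \<and>
        \<Delta> \<beta> = tens \<beta> \<alpha> \<oplus>\<^bsub>T\<^esub> tens (star A \<alpha>) \<beta>)"


section \<open>Multilinear functionals, convolution and invariance\<close>

text \<open>An \<open>m\<close>-linear functional is a function on the lists of length \<open>m\<close> over the carrier.\<close>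

definition arg_lists :: "('a, 'x) star_alg_scheme \<Rightarrow> nat \<Rightarrow> 'a list set" where
  "arg_lists A m = {as. length as = m \<and> set as \<subseteq> carrier A}"

definition multilinear :: "('a, 'x) star_alg_scheme \<Rightarrow> nat \<Rightarrow> ('a list \<Rightarrow> complex) \<Rightarrow> bool" where
  "multilinear A m \<phi> \<longleftrightarrow>
     (\<forall>as\<in>arg_lists A m. \<forall>i<m. linear_functional A (\<lambda>x. \<phi> (as[i := x])))"

text \<open>
  A Sweedler decomposition \<open>\<Delta>(a) = \<Sum> x\<^sub>j \<otimes> y\<^sub>j\<close>, as the list of the pairs \<open>(x\<^sub>j, y\<^sub>j)\<close>. For multilinear
  \<open>\<phi>\<close> and linear \<open>\<psi>\<close> the convolution does not depend on the decompositions chosen.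
\<close>

definition tensor_sum :: "('a, 'x) star_alg_scheme \<Rightarrow> ('a \<times> 'a) list \<Rightarrow> ('a \<times> 'a \<Rightarrow>\<^sub>0 complex) set" where
  "tensor_sum A ps =
     foldr (\<lambda>(x, y) t. pure_tensor A A x y \<oplus>\<^bsub>tensor_alg A A\<^esub> t) ps \<zero>\<^bsub>tensor_alg A A\<^esub>"

definition sweedler ::
    "('a, 'x) star_alg_scheme \<Rightarrow> ('a \<Rightarrow> ('a \<times> 'a \<Rightarrow>\<^sub>0 complex) set) \<Rightarrow> 'a \<Rightarrow> ('a \<times> 'a) list" where
  "sweedler A \<Delta> a = (SOME ps. set ps \<subseteq> carrier A \<times> carrier A \<and> tensor_sum A ps = \<Delta> a)"

definition list_mult :: "('a, 'x) star_alg_scheme \<Rightarrow> 'a list \<Rightarrow> 'a" where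
  "list_mult A as = foldr (\<lambda>x y. x \<otimes>\<^bsub>A\<^esub> y) as \<one>\<^bsub>A\<^esub>"

definition convolution ::
    "('a, 'x) star_alg_scheme \<Rightarrow> ('a \<Rightarrow> ('a \<times> 'a \<Rightarrow>\<^sub>0 complex) set) \<Rightarrow>
     ('a list \<Rightarrow> complex) \<Rightarrow> ('a \<Rightarrow> complex) \<Rightarrow> 'a list \<Rightarrow> complex" where
  "convolution A \<Delta> \<phi> \<psi> as =
     (\<Sum>ps\<leftarrow>product_lists (map (sweedler A \<Delta>) as). \<phi> (map fst ps) * \<psi> (list_mult A (map snd ps)))"

definition invariant_functional ::
    "('a, 'x) star_alg_scheme \<Rightarrow> ('a \<Rightarrow> ('a \<times> 'a \<Rightarrow>\<^sub>0 complex) set) \<Rightarrow> nat \<Rightarrow>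
     ('a list \<Rightarrow> complex) \<Rightarrow> bool" where
  "invariant_functional A \<Delta> m \<phi> \<longleftrightarrow> multilinear A m \<phi> \<and>
     (\<forall>\<psi>. linear_functional A \<psi> \<longrightarrow>
        (\<forall>as\<in>arg_lists A m. convolution A \<Delta> \<phi> \<psi> as = \<psi> \<one>\<^bsub>A\<^esub> * \<phi> as))"


section \<open>Cyclic cohomology\<close>

definition hochschild_b ::
    "('a, 'x) star_alg_scheme \<Rightarrow> nat \<Rightarrow> ('a list \<Rightarrow> complex) \<Rightarrow> 'a list \<Rightarrow> complex" where
  "hochschild_b A n \<phi> as =
     (\<Sum>i\<le>n. (- 1) ^ i * \<phi> (take i as @ [as ! i \<otimes>\<^bsub>A\<^esub> as ! Suc i] @ drop (Suc (Suc i)) as)) +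
     (- 1) ^ Suc n * \<phi> ((as ! Suc n \<otimes>\<^bsub>A\<^esub> as ! 0) # take n (drop 1 as))"

definition cyclic_cochain ::
    "('a, 'x) star_alg_scheme \<Rightarrow> nat \<Rightarrow> ('a list \<Rightarrow> complex) \<Rightarrow> bool" where
  "cyclic_cochain A n \<phi> \<longleftrightarrow> multilinear A (Suc n) \<phi> \<and>
     (\<forall>as\<in>arg_lists A (Suc n). \<phi> (last as # butlast as) = (- 1) ^ n * \<phi> as)"

definition cyclic_cocycle ::
    "('a, 'x) star_alg_scheme \<Rightarrow> nat \<Rightarrow> ('a list \<Rightarrow> complex) \<Rightarrow> bool" where
  "cyclic_cocycle A n \<phi> \<longleftrightarrow> cyclic_cochain A n \<phi> \<and>
     (\<forall>as\<in>arg_lists A (Suc (Suc n)). hochschild_b A n \<phi> as = 0)"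

text \<open>There are no cochains below degree \<open>0\<close>, so the only coboundary in degree \<open>0\<close> is zero.\<close>

definition cyclic_coboundary ::
    "('a, 'x) star_alg_scheme \<Rightarrow> nat \<Rightarrow> ('a list \<Rightarrow> complex) \<Rightarrow> bool" where
  "cyclic_coboundary A n \<phi> \<longleftrightarrow>
     (case n of
        0 \<Rightarrow> \<forall>as\<in>arg_lists A 1. \<phi> as = 0
      | Suc k \<Rightarrow> \<exists>\<eta>. cyclic_cochain A k \<eta> \<and>
                  (\<forall>as\<in>arg_lists A (Suc n). \<phi> as = hochschild_b A k \<eta> as))"

definition HC_class ::
    "('a, 'x) star_alg_scheme \<Rightarrow> nat \<Rightarrow> ('a list \<Rightarrow> complex) \<Rightarrow> ('a list \<Rightarrow> complex) set" where
  "HC_class A n \<phi> = {\<phi>'. cyclic_cocycle A n \<phi>' \<and> cyclic_coboundary A n (\<lambda>as. \<phi>' as - \<phi> as)}"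

definition invariant_class ::
    "('a, 'x) star_alg_scheme \<Rightarrow> ('a \<Rightarrow> ('a \<times> 'a \<Rightarrow>\<^sub>0 complex) set) \<Rightarrow> nat \<Rightarrow>
     ('a list \<Rightarrow> complex) set \<Rightarrow> bool" where
  "invariant_class A \<Delta> n C \<longleftrightarrow>
     (\<exists>\<phi>'. invariant_functional A \<Delta> (Suc n) \<phi>' \<and> cyclic_cocycle A n \<phi>' \<and> HC_class A n \<phi>' = C)"

definition cochain0 :: "('a \<Rightarrow> complex) \<Rightarrow> 'a list \<Rightarrow> complex" where
  "cochain0 \<tau> as = \<tau> (hd as)"


section \<open>The Hilbert space \<open>\<ell>\<^sup>2(\<nat>)\<close>\<close>

typedef ell2 = "{f :: nat \<Rightarrow> complex. summable (\<lambda>n. (norm (f n))\<^sup>2)}"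
  morphisms ell2_coord Abs_ell2
  by (rule exI[of _ "\<lambda>_. 0"]) simp

setup_lifting type_definition_ell2

lemma ell2_summable_inner:
  fixes f g :: "nat \<Rightarrow> complex"
  assumes "summable (\<lambda>n. (norm (f n))\<^sup>2)" "summable (\<lambda>n. (norm (g n))\<^sup>2)"
  shows "summable (\<lambda>n. inner (f n) (g n))"
proof (rule summable_comparison_test'[OF summable_add[OF assms]])
  fix n :: nat
  have "norm (inner (f n) (g n)) \<le> norm (f n) * norm (g n)"
    by (simp add: Cauchy_Schwarz_ineq2)
  also have "\<dots> \<le> (norm (f n))\<^sup>2 + (norm (g n))\<^sup>2"
    using sum_squares_bound[of "norm (f n)" "norm (g n)"]
      mult_nonneg_nonneg[OF norm_ge_zero[of "f n"] norm_ge_zero[of "g n"]] by linarith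
  finally show "norm (inner (f n) (g n)) \<le> (norm (f n))\<^sup>2 + (norm (g n))\<^sup>2" .
qed

lemma ell2_summable_add:
  fixes f g :: "nat \<Rightarrow> complex"
  assumes "summable (\<lambda>n. (norm (f n))\<^sup>2)" "summable (\<lambda>n. (norm (g n))\<^sup>2)"
  shows "summable (\<lambda>n. (norm (f n + g n))\<^sup>2)"
proof -
  have "(norm (f n + g n))\<^sup>2 = (norm (f n))\<^sup>2 + (norm (g n))\<^sup>2 + 2 * inner (f n) (g n)" for n
    by (simp add: power2_norm_eq_inner inner_add inner_commute)
  then show ?thesis
    by (simp only:) (intro summable_add summable_mult ell2_summable_inner assms)
qed

lemma ell2_summable_mult:
  fixes f :: "nat \<Rightarrow> complex"
  assumes "summable (\<lambda>n. (norm (f n))\<^sup>2)"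
  shows "summable (\<lambda>n. (norm (c * f n))\<^sup>2)"
  using summable_mult[OF assms, of "(norm c)\<^sup>2"] by (simp add: norm_mult power_mult_distrib)

text \<open>The real inner product below is the real part of the complex one.\<close>

instantiation ell2 :: real_inner
begin

lift_definition zero_ell2 :: ell2 is "\<lambda>_. 0" by simp
lift_definition plus_ell2 :: "ell2 \<Rightarrow> ell2 \<Rightarrow> ell2" is "\<lambda>f g n. f n + g n"
  by (rule ell2_summable_add)
lift_definition uminus_ell2 :: "ell2 \<Rightarrow> ell2" is "\<lambda>f n. - f n" by simp
lift_definition minus_ell2 :: "ell2 \<Rightarrow> ell2 \<Rightarrow> ell2" is "\<lambda>f g n. f n - g n"
  subgoal for f g using ell2_summable_add[of f "\<lambda>n. - g n"] by simp
  done
lift_definition scaleR_ell2 :: "real \<Rightarrow> ell2 \<Rightarrow> ell2" is "\<lambda>r f n. of_real r * f n"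
  by (rule ell2_summable_mult)
lift_definition inner_ell2 :: "ell2 \<Rightarrow> ell2 \<Rightarrow> real" is "\<lambda>f g. suminf (\<lambda>n. inner (f n) (g n))" .

definition norm_ell2 :: "ell2 \<Rightarrow> real" where "norm_ell2 x = sqrt (inner x x)"
definition sgn_ell2 :: "ell2 \<Rightarrow> ell2" where "sgn_ell2 x = scaleR (inverse (norm x)) x"
definition dist_ell2 :: "ell2 \<Rightarrow> ell2 \<Rightarrow> real" where "dist_ell2 x y = norm (x - y)"
definition uniformity_ell2 :: "(ell2 \<times> ell2) filter" where
  "uniformity_ell2 = (INF e\<in>{0<..}. principal {(x, y). dist x y < e})"
definition open_ell2 :: "ell2 set \<Rightarrow> bool" where
  "open_ell2 U \<longleftrightarrow> (\<forall>x\<in>U. eventually (\<lambda>(x', y). x' = x \<longrightarrow> y \<in> U) uniformity)"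

instance
proof
  fix x y z :: ell2 and a b r :: real
  show "x + y + z = x + (y + z)" by transfer (simp add: add.assoc)
  show "x + y = y + x" by transfer (simp add: add.commute)
  show "0 + x = x" by transfer simp
  show "- x + x = 0" by transfer simp
  show "x - y = x + - y" by transfer simp
  show "a *\<^sub>R (x + y) = a *\<^sub>R x + a *\<^sub>R y" by transfer (simp add: algebra_simps)
  show "(a + b) *\<^sub>R x = a *\<^sub>R x + b *\<^sub>R x" by transfer (simp add: algebra_simps)
  show "a *\<^sub>R b *\<^sub>R x = (a * b) *\<^sub>R x" by transfer (simp add: algebra_simps)
  show "1 *\<^sub>R x = x" by transfer simp
  show "dist x y = norm (x - y)" by (rule dist_ell2_def)
  show "sgn x = scaleR (inverse (norm x)) x" by (rule sgn_ell2_def)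
  show "(uniformity :: (ell2 \<times> ell2) filter) = (INF e\<in>{0<..}. principal {(x, y). dist x y < e})"
    by (rule uniformity_ell2_def)
  show "open U \<longleftrightarrow> (\<forall>x\<in>U. eventually (\<lambda>(x', y). x' = x \<longrightarrow> y \<in> U) uniformity)" for U :: "ell2 set"
    by (rule open_ell2_def)
  show "inner x y = inner y x" by transfer (simp add: inner_commute)
  show "inner (x + y) z = inner x z + inner y z"
    by transfer (simp add: inner_add_left suminf_add ell2_summable_inner)
  show "inner (r *\<^sub>R x) y = r * inner x y"
  proof transfer
    fix r :: real and f g :: "nat \<Rightarrow> complex"
    assume "summable (\<lambda>n. (norm (f n))\<^sup>2)" "summable (\<lambda>n. (norm (g n))\<^sup>2)"
    then have "summable (\<lambda>n. inner (f n) (g n))" by (rule ell2_summable_inner)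
    moreover have "inner (of_real r * f n) (g n) = r * inner (f n) (g n)" for n
      by (metis inner_scaleR_left scaleR_conv_of_real)
    ultimately show "suminf (\<lambda>n. inner (of_real r * f n) (g n)) = r * suminf (\<lambda>n. inner (f n) (g n))"
      by (simp add: suminf_mult)
  qed
  show "0 \<le> inner x x"
    by transfer (simp add: suminf_nonneg flip: power2_norm_eq_inner)
  show "(inner x x = 0) = (x = 0)"
    by transfer (simp add: suminf_eq_zero_iff fun_eq_iff flip: power2_norm_eq_inner)
  show "norm x = sqrt (inner x x)" by (rule norm_ell2_def)
qed

end

lift_definition ell2_scaleC :: "complex \<Rightarrow> ell2 \<Rightarrow> ell2" is "\<lambda>c f n. c * f n"
  by (rule ell2_summable_mult)

lift_definition ell2_basis :: "nat \<Rightarrow> ell2" is "\<lambda>i n. if n = i then 1 else 0"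
  subgoal for i by (rule summable_finite[of "{i}"]) auto
  done


section \<open>Operators on \<open>\<ell>\<^sup>2(\<nat>)\<close>\<close>

type_synonym oper = "ell2 \<Rightarrow>\<^sub>L ell2"

definition complex_linear :: "oper \<Rightarrow> bool" where
  "complex_linear T \<longleftrightarrow> (\<forall>c x. blinfun_apply T (ell2_scaleC c x) = ell2_scaleC c (blinfun_apply T x))"

text \<open>For a complex linear operator the adjoint for the real inner product is the Hilbert space adjoint.\<close>

definition adj :: "oper \<Rightarrow> oper" where
  "adj T = Blinfun (adjoint (blinfun_apply T))"

definition compact_oper :: "oper \<Rightarrow> bool" where
  "compact_oper T \<longleftrightarrow> compact (closure (blinfun_apply T ` cball 0 1))"

definition positive_oper :: "oper \<Rightarrow> bool" where
  "positive_oper P \<longleftrightarrow> complex_linear P \<and> adj P = P \<and> (\<forall>x. 0 \<le> inner x (blinfun_apply P x))"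

text \<open>\<open>P\<close> is \<open>\<bar>T\<bar>\<close>, the positive square root of \<open>T\<^sup>* T\<close>.\<close>

definition trace_class :: "oper \<Rightarrow> bool" where
  "trace_class T \<longleftrightarrow> complex_linear T \<and>
     (\<exists>P. positive_oper P \<and> P o\<^sub>L P = adj T o\<^sub>L T \<and>
          summable (\<lambda>n. inner (ell2_basis n) (blinfun_apply P (ell2_basis n))))"

definition oper_trace :: "oper \<Rightarrow> complex" where
  "oper_trace T = suminf (\<lambda>n. ell2_coord (blinfun_apply T (ell2_basis n)) n)"

definition commutator :: "oper \<Rightarrow> oper \<Rightarrow> oper" where
  "commutator S T = (S o\<^sub>L T) - (T o\<^sub>L S)"


section \<open>Even Fredholm modules and even K-homology\<close>

text \<open>
  All Fredholm modules live on \<open>\<ell>\<^sup>2(\<nat>)\<close>. Representations need not be unital, so a module on any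
  separable Hilbert space can be moved there by adding a degenerate module with zero representation.
  The grading operator \<open>fgrad\<close> replaces the decomposition \<open>H = H\<^sup>+ \<oplus> H\<^sup>-\<close>.
\<close>

record 'a fredmod =
  frep :: "'a \<Rightarrow> oper"
  fop :: oper
  fgrad :: oper

definition star_representation :: "('a, 'x) star_alg_scheme \<Rightarrow> ('a \<Rightarrow> oper) \<Rightarrow> bool" where
  "star_representation A \<pi> \<longleftrightarrow>
     (\<forall>a\<in>carrier A. complex_linear (\<pi> a)) \<and>
     (\<forall>a\<in>carrier A. \<forall>b\<in>carrier A. \<pi> (a \<oplus>\<^bsub>A\<^esub> b) = \<pi> a + \<pi> b \<and> \<pi> (a \<otimes>\<^bsub>A\<^esub> b) = \<pi> a o\<^sub>L \<pi> b) \<and>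
     (\<forall>c. \<forall>a\<in>carrier A. \<forall>x.
        blinfun_apply (\<pi> (cscale A c a)) x = ell2_scaleC c (blinfun_apply (\<pi> a) x)) \<and>
     (\<forall>a\<in>carrier A. \<pi> (star A a) = adj (\<pi> a))"

definition even_fredholm_module :: "('a, 'x) star_alg_scheme \<Rightarrow> 'a fredmod \<Rightarrow> bool" where
  "even_fredholm_module A M \<longleftrightarrow>
     star_representation A (frep M) \<and> complex_linear (fop M) \<and> complex_linear (fgrad M) \<and>
     adj (fgrad M) = fgrad M \<and> fgrad M o\<^sub>L fgrad M = id_blinfun \<and>
     fgrad M o\<^sub>L fop M = - (fop M o\<^sub>L fgrad M) \<and>
     (\<forall>a\<in>carrier A.
        commutator (fgrad M) (frep M a) = 0 \<and>
        compact_oper (commutator (fop M) (frep M a)) \<and>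
        compact_oper (frep M a o\<^sub>L ((fop M o\<^sub>L fop M) - id_blinfun)) \<and>
        compact_oper (frep M a o\<^sub>L (fop M - adj (fop M))))"

definition isometry_oper :: "oper \<Rightarrow> bool" where
  "isometry_oper V \<longleftrightarrow> complex_linear V \<and> adj V o\<^sub>L V = id_blinfun"

definition intertwines ::
    "('a, 'x) star_alg_scheme \<Rightarrow> oper \<Rightarrow> 'a fredmod \<Rightarrow> 'a fredmod \<Rightarrow> bool" where
  "intertwines A V M N \<longleftrightarrow>
     (\<forall>a\<in>carrier A. V o\<^sub>L frep M a = frep N a o\<^sub>L V) \<and>
     V o\<^sub>L fop M = fop N o\<^sub>L V \<and> V o\<^sub>L fgrad M = fgrad N o\<^sub>L V"

definition unitarily_equivalent ::
    "('a, 'x) star_alg_scheme \<Rightarrow> 'a fredmod \<Rightarrow> 'a fredmod \<Rightarrow> bool" where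
  "unitarily_equivalent A M N \<longleftrightarrow>
     (\<exists>U. isometry_oper U \<and> U o\<^sub>L adj U = id_blinfun \<and> intertwines A U M N)"

definition operator_homotopic ::
    "('a, 'x) star_alg_scheme \<Rightarrow> 'a fredmod \<Rightarrow> 'a fredmod \<Rightarrow> bool" where
  "operator_homotopic A M N \<longleftrightarrow>
     (\<exists>F :: real \<Rightarrow> oper. continuous_on {0..1} F \<and>
        (\<forall>t\<in>{0..1}. even_fredholm_module A (M\<lparr>fop := F t\<rparr>)) \<and>
        M\<lparr>fop := F 0\<rparr> = M \<and> M\<lparr>fop := F 1\<rparr> = N)"

text \<open>\<open>L\<close> is an orthogonal direct sum of \<open>M\<close> and \<open>N\<close>, embedded by the isometries \<open>V\<close> and \<open>W\<close>.\<close>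

definition is_direct_sum ::
    "('a, 'x) star_alg_scheme \<Rightarrow> 'a fredmod \<Rightarrow> 'a fredmod \<Rightarrow> 'a fredmod \<Rightarrow> bool" where
  "is_direct_sum A L M N \<longleftrightarrow>
     (\<exists>V W. isometry_oper V \<and> isometry_oper W \<and> (V o\<^sub>L adj V) + (W o\<^sub>L adj W) = id_blinfun \<and>
            intertwines A V M L \<and> intertwines A W N L)"

text \<open>
  \<open>K\<^sup>0\<close> as the abelian group with one generator for each even Fredholm module, subject to the relations
  given by unitary equivalence, operator homotopy and direct sums.
\<close>

definition K0_relators :: "('a, 'x) star_alg_scheme \<Rightarrow> ('a fredmod \<Rightarrow>\<^sub>0 int) set" where
  "K0_relators A =
     {frag_of M - frag_of N | M N.
        even_fredholm_module A M \<and> even_fredholm_module A N \<and>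
        (unitarily_equivalent A M N \<or> operator_homotopic A M N)} \<union>
     {frag_of L - frag_of M - frag_of N | L M N.
        even_fredholm_module A L \<and> even_fredholm_module A M \<and> even_fredholm_module A N \<and>
        is_direct_sum A L M N}"

definition K0_null :: "('a, 'x) star_alg_scheme \<Rightarrow> ('a fredmod \<Rightarrow>\<^sub>0 int) set" where
  "K0_null A = generate (free_Abelian_group (Collect (even_fredholm_module A))) (K0_relators A)"

definition K0_homology :: "('a, 'x) star_alg_scheme \<Rightarrow> ('a fredmod \<Rightarrow>\<^sub>0 int) set monoid" where
  "K0_homology A = free_Abelian_group (Collect (even_fredholm_module A)) Mod K0_null A"

definition K0_class :: "('a, 'x) star_alg_scheme \<Rightarrow> 'a fredmod \<Rightarrow> ('a fredmod \<Rightarrow>\<^sub>0 int) set" where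
  "K0_class A M = K0_null A #>\<^bsub>free_Abelian_group (Collect (even_fredholm_module A))\<^esub> frag_of M"

definition K0_generator :: "('a, 'x) star_alg_scheme \<Rightarrow> ('a fredmod \<Rightarrow>\<^sub>0 int) set \<Rightarrow> bool" where
  "K0_generator A g \<longleftrightarrow>
     g \<in> carrier (K0_homology A) \<and> generate (K0_homology A) {g} = carrier (K0_homology A)"


section \<open>The Chern character in degree zero\<close>

definition one_summable :: "('a, 'x) star_alg_scheme \<Rightarrow> 'a fredmod \<Rightarrow> bool" where
  "one_summable A M \<longleftrightarrow> even_fredholm_module A M \<and>
     adj (fop M) = fop M \<and> fop M o\<^sub>L fop M = id_blinfun \<and>
     (\<forall>a\<in>carrier A. trace_class (commutator (fop M) (frep M a)))"

text \<open>Connes' character \<open>a \<mapsto> Tr (\<gamma> F [F, a]) / 2\<close> of a \<open>1\<close>-summable even Fredholm module.\<close>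

definition fredholm_character :: "'a fredmod \<Rightarrow> 'a \<Rightarrow> complex" where
  "fredholm_character M a =
     oper_trace (fgrad M o\<^sub>L fop M o\<^sub>L commutator (fop M) (frep M a)) / 2"

definition chern_character_of ::
    "('a, 'x) star_alg_scheme \<Rightarrow> ('a list \<Rightarrow> complex) set \<Rightarrow> ('a fredmod \<Rightarrow>\<^sub>0 int) set \<Rightarrow> bool" where
  "chern_character_of A C g \<longleftrightarrow>
     (\<exists>M. one_summable A M \<and> K0_class A M = g \<and> HC_class A 0 (cochain0 (fredholm_character M)) = C)"

end

theory Submission
  imports Defs
begin

text \<open>
  A trace \<open>\<tau>\<close> with \<open>\<tau>(1) = 1\<close> is constrained by the relations: \<open>\<alpha>\<^sup>*\<alpha> + \<beta>\<^sup>*\<beta> = 1 = \<alpha>\<alpha>\<^sup>* + q\<^sup>2\<beta>\<beta>\<^sup>*\<close>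
  gives \<open>\<tau>(\<beta>\<beta>\<^sup>*) = 0\<close>, hence \<open>\<tau>(\<alpha>\<^sup>*\<alpha>) = 1\<close>, and \<open>q\<close>-commutation gives \<open>\<tau>(\<beta>\<alpha>) = \<tau>(\<alpha>\<^sup>*\<beta>\<^sup>*) = 0\<close>. In degree
  \<open>0\<close> there are no coboundaries, so an invariant class would make \<open>\<tau>\<close> itself invariant. Evaluated at
  \<open>\<beta>\<beta>\<^sup>*\<close>, whose coproduct is \<open>\<beta>\<beta>\<^sup>* \<otimes> \<alpha>\<alpha>\<^sup>* + \<beta>\<alpha> \<otimes> \<alpha>\<beta>\<^sup>* + \<alpha>\<^sup>*\<beta>\<^sup>* \<otimes> \<beta>\<alpha>\<^sup>* + \<alpha>\<^sup>*\<alpha> \<otimes> \<beta>\<beta>\<^sup>*\<close>, invariance says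
  \<open>\<psi>(\<beta>\<beta>\<^sup>*) = 0\<close> for all \<open>\<psi>\<close>. A matrix coefficient of the representation by weighted shifts violates this.
\<close>

section \<open>Monoid algebras\<close>

lemma carrier_monoid_algebra:
  "t \<in> carrier (monoid_algebra M) \<longleftrightarrow> Poly_Mapping.keys t \<subseteq> carrier M"
  by (simp add: monoid_algebra_def)

lemma monoid_algebra_simps [simp]:
  "\<one>\<^bsub>monoid_algebra M\<^esub> = Poly_Mapping.single \<one>\<^bsub>M\<^esub> 1"
  "\<zero>\<^bsub>monoid_algebra M\<^esub> = 0"
  "s \<oplus>\<^bsub>monoid_algebra M\<^esub> t = s + t"
  by (simp_all add: monoid_algebra_def)

text \<open>A sum can have fewer keys than its summands because of cancellation. Padding all index
  sets to a common finite superset, where the extra coefficients vanish, reduces distributivity to a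
  rearrangement of finite sums.\<close>

lemma monoid_algebra_mult_superset:
  assumes "finite K" "finite L" "Poly_Mapping.keys s \<subseteq> K" "Poly_Mapping.keys t \<subseteq> L"
  shows "s \<otimes>\<^bsub>monoid_algebra M\<^esub> t = (\<Sum>k\<in>K. \<Sum>l\<in>L.
    Poly_Mapping.single (k \<otimes>\<^bsub>M\<^esub> l) (Poly_Mapping.lookup s k * Poly_Mapping.lookup t l))"
proof -
  have "s \<otimes>\<^bsub>monoid_algebra M\<^esub> t = (\<Sum>k\<in>K. \<Sum>l\<in>Poly_Mapping.keys t.
      Poly_Mapping.single (k \<otimes>\<^bsub>M\<^esub> l) (Poly_Mapping.lookup s k * Poly_Mapping.lookup t l))"
    using assms by (auto simp: monoid_algebra_def in_keys_iff intro!: sum.mono_neutral_left)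
  also have "\<dots> = (\<Sum>k\<in>K. \<Sum>l\<in>L.
      Poly_Mapping.single (k \<otimes>\<^bsub>M\<^esub> l) (Poly_Mapping.lookup s k * Poly_Mapping.lookup t l))"
    using assms by (intro sum.cong refl sum.mono_neutral_left) (auto simp: in_keys_iff)
  finally show ?thesis .
qed

lemma monoid_algebra_mult_add_left:
  "(s + s') \<otimes>\<^bsub>monoid_algebra M\<^esub> t = s \<otimes>\<^bsub>monoid_algebra M\<^esub> t + s' \<otimes>\<^bsub>monoid_algebra M\<^esub> t"
proof -
  let ?K = "Poly_Mapping.keys s \<union> Poly_Mapping.keys s'"
  have "Poly_Mapping.keys (s + s') \<subseteq> ?K" by (rule keys_add)
  then show ?thesis
    by (simp add: monoid_algebra_mult_superset[of ?K "Poly_Mapping.keys t"] lookup_add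
        distrib_right single_add sum.distrib)
qed

lemma monoid_algebra_mult_add_right:
  "t \<otimes>\<^bsub>monoid_algebra M\<^esub> (s + s') = t \<otimes>\<^bsub>monoid_algebra M\<^esub> s + t \<otimes>\<^bsub>monoid_algebra M\<^esub> s'"
proof -
  let ?K = "Poly_Mapping.keys s \<union> Poly_Mapping.keys s'"
  have "Poly_Mapping.keys (s + s') \<subseteq> ?K" by (rule keys_add)
  then show ?thesis
    by (simp add: monoid_algebra_mult_superset[of "Poly_Mapping.keys t" ?K] lookup_add
        distrib_left single_add sum.distrib)
qed

lemma monoid_algebra_mult_zero [simp]:
  "0 \<otimes>\<^bsub>monoid_algebra M\<^esub> t = 0" "t \<otimes>\<^bsub>monoid_algebra M\<^esub> 0 = 0"
  by (simp_all add: monoid_algebra_def)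

lemma monoid_algebra_mult_single [simp]:
  "Poly_Mapping.single k a \<otimes>\<^bsub>monoid_algebra M\<^esub> Poly_Mapping.single l b =
     Poly_Mapping.single (k \<otimes>\<^bsub>M\<^esub> l) (a * b)"
  by (subst monoid_algebra_mult_superset[of "{k}" "{l}"]) auto

lemma monoid_algebra_mult_sum_left:
  "(\<Sum>i\<in>X. f i) \<otimes>\<^bsub>monoid_algebra M\<^esub> t = (\<Sum>i\<in>X. f i \<otimes>\<^bsub>monoid_algebra M\<^esub> t)"
  by (induction X rule: infinite_finite_induct) (auto simp: monoid_algebra_mult_add_left)

lemma monoid_algebra_mult_sum_right:
  "t \<otimes>\<^bsub>monoid_algebra M\<^esub> (\<Sum>i\<in>X. f i) = (\<Sum>i\<in>X. t \<otimes>\<^bsub>monoid_algebra M\<^esub> f i)"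
  by (induction X rule: infinite_finite_induct) (auto simp: monoid_algebra_mult_add_right)

lemma poly_mapping_eq_sum_single:
  "t = (\<Sum>k\<in>Poly_Mapping.keys t. Poly_Mapping.single k (Poly_Mapping.lookup t k))"
  by (rule poly_mapping_eqI) (auto simp: lookup_sum lookup_single when_def in_keys_iff)

section \<open>Ring axioms for the monoid algebra\<close>

lemma monoid_algebra_mult_closed:
  assumes "monoid M" "s \<in> carrier (monoid_algebra M)" "t \<in> carrier (monoid_algebra M)"
  shows "s \<otimes>\<^bsub>monoid_algebra M\<^esub> t \<in> carrier (monoid_algebra M)"
proof -
  let ?f = "\<lambda>k l. Poly_Mapping.single (k \<otimes>\<^bsub>M\<^esub> l) (Poly_Mapping.lookup s k * Poly_Mapping.lookup t l)"
  have "Poly_Mapping.keys (?f k l) \<subseteq> carrier M"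
    if "k \<in> Poly_Mapping.keys s" "l \<in> Poly_Mapping.keys t" for k l
    using that assms by (auto simp: carrier_monoid_algebra intro!: monoid.m_closed)
  moreover have "s \<otimes>\<^bsub>monoid_algebra M\<^esub> t =
      (\<Sum>k\<in>Poly_Mapping.keys s. \<Sum>l\<in>Poly_Mapping.keys t. ?f k l)"
    by (simp add: monoid_algebra_def)
  ultimately show ?thesis
    unfolding carrier_monoid_algebra
    by (auto intro!: order_trans[OF keys_sum] UN_least simp del: keys_single)
qed

text \<open>Both products expand into monomials, where the law becomes associativity in
  \<open>M\<close>; the carrier hypotheses put all keys where \<open>M\<close> satisfies it.\<close>

lemma monoid_algebra_mult_assoc:
  assumes "monoid M" and "s \<in> carrier (monoid_algebra M)" "t \<in> carrier (monoid_algebra M)"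
    "u \<in> carrier (monoid_algebra M)"
  shows "s \<otimes>\<^bsub>monoid_algebra M\<^esub> t \<otimes>\<^bsub>monoid_algebra M\<^esub> u =
    s \<otimes>\<^bsub>monoid_algebra M\<^esub> (t \<otimes>\<^bsub>monoid_algebra M\<^esub> u)"
proof -
  let ?e = "\<lambda>t k. Poly_Mapping.single k (Poly_Mapping.lookup t k)"
  have "(\<Sum>k\<in>Poly_Mapping.keys s. ?e s k) \<otimes>\<^bsub>monoid_algebra M\<^esub>
      (\<Sum>l\<in>Poly_Mapping.keys t. ?e t l) \<otimes>\<^bsub>monoid_algebra M\<^esub> (\<Sum>m\<in>Poly_Mapping.keys u. ?e u m) =
    (\<Sum>k\<in>Poly_Mapping.keys s. ?e s k) \<otimes>\<^bsub>monoid_algebra M\<^esub>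
      ((\<Sum>l\<in>Poly_Mapping.keys t. ?e t l) \<otimes>\<^bsub>monoid_algebra M\<^esub> (\<Sum>m\<in>Poly_Mapping.keys u. ?e u m))"
    unfolding monoid_algebra_mult_sum_left monoid_algebra_mult_sum_right monoid_algebra_mult_single
    using assms
    by (intro sum.cong refl)
      (auto simp: carrier_monoid_algebra subset_iff monoid.m_assoc mult.assoc)
  then show ?thesis by (simp flip: poly_mapping_eq_sum_single)
qed

lemma monoid_algebra_one_mult:
  assumes "monoid M" "s \<in> carrier (monoid_algebra M)"
  shows "Poly_Mapping.single \<one>\<^bsub>M\<^esub> 1 \<otimes>\<^bsub>monoid_algebra M\<^esub> s = s"
    "s \<otimes>\<^bsub>monoid_algebra M\<^esub> Poly_Mapping.single \<one>\<^bsub>M\<^esub> 1 = s"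
proof -
  let ?s = "\<Sum>k\<in>Poly_Mapping.keys s. Poly_Mapping.single k (Poly_Mapping.lookup s k)"
  have "Poly_Mapping.single \<one>\<^bsub>M\<^esub> 1 \<otimes>\<^bsub>monoid_algebra M\<^esub> ?s = ?s \<and>
      ?s \<otimes>\<^bsub>monoid_algebra M\<^esub> Poly_Mapping.single \<one>\<^bsub>M\<^esub> 1 = ?s"
    unfolding monoid_algebra_mult_sum_left monoid_algebra_mult_sum_right monoid_algebra_mult_single
    using assms by (auto simp: carrier_monoid_algebra subset_iff monoid.l_one monoid.r_one
        intro!: sum.cong)
  then show "Poly_Mapping.single \<one>\<^bsub>M\<^esub> 1 \<otimes>\<^bsub>monoid_algebra M\<^esub> s = s"
    "s \<otimes>\<^bsub>monoid_algebra M\<^esub> Poly_Mapping.single \<one>\<^bsub>M\<^esub> 1 = s"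
    by (simp_all flip: poly_mapping_eq_sum_single)
qed

text \<open>A multiple of the unit commutes with every basis element. Scaling in the quotient is
  left multiplication by such a multiple, so this lets scalars pass to the right factor of a
  product.\<close>

lemma monoid_algebra_scalar_central:
  assumes "monoid M" "s \<in> carrier (monoid_algebra M)"
  shows "s \<otimes>\<^bsub>monoid_algebra M\<^esub> Poly_Mapping.single \<one>\<^bsub>M\<^esub> c =
    Poly_Mapping.single \<one>\<^bsub>M\<^esub> c \<otimes>\<^bsub>monoid_algebra M\<^esub> s"
proof -
  let ?s = "\<Sum>k\<in>Poly_Mapping.keys s. Poly_Mapping.single k (Poly_Mapping.lookup s k)"
  have "?s \<otimes>\<^bsub>monoid_algebra M\<^esub> Poly_Mapping.single \<one>\<^bsub>M\<^esub> c =
      Poly_Mapping.single \<one>\<^bsub>M\<^esub> c \<otimes>\<^bsub>monoid_algebra M\<^esub> ?s"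
    unfolding monoid_algebra_mult_sum_left monoid_algebra_mult_sum_right monoid_algebra_mult_single
    using assms by (auto simp: carrier_monoid_algebra subset_iff monoid.l_one monoid.r_one
        mult.commute intro!: sum.cong)
  then show ?thesis by (simp flip: poly_mapping_eq_sum_single)
qed

lemma monoid_algebra_ring:
  assumes "monoid M"
  shows "ring (monoid_algebra M)"
proof (rule ringI)
  show "abelian_group (monoid_algebra M)"
  proof (rule abelian_groupI)
    fix x y z assume "x \<in> carrier (monoid_algebra M)" "y \<in> carrier (monoid_algebra M)"
    then show "x \<oplus>\<^bsub>monoid_algebra M\<^esub> y \<in> carrier (monoid_algebra M)"
      using keys_add[of x y] by (auto simp: carrier_monoid_algebra)
    show "\<exists>y\<in>carrier (monoid_algebra M). y \<oplus>\<^bsub>monoid_algebra M\<^esub> x = \<zero>\<^bsub>monoid_algebra M\<^esub>"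
      using \<open>x \<in> _\<close> by (intro bexI[of _ "- x"]) (auto simp: carrier_monoid_algebra)
  qed (auto simp: carrier_monoid_algebra add_ac)
  show "monoid (monoid_algebra M)"
    using assms by (intro monoidI)
      (auto simp: monoid_algebra_mult_closed monoid_algebra_mult_assoc monoid_algebra_one_mult,
       auto simp: carrier_monoid_algebra monoid.one_closed)
qed (simp_all add: monoid_algebra_mult_add_left monoid_algebra_mult_add_right)

lemma monoid_algebra_scalar_carrier:
  "monoid M \<Longrightarrow> Poly_Mapping.single \<one>\<^bsub>M\<^esub> c \<in> carrier (monoid_algebra M)"
  by (auto simp: carrier_monoid_algebra monoid.one_closed)

section \<open>Ideals of monoid algebras and their cosets\<close>

lemma uminus_monoid_algebra:
  assumes "monoid M" "s \<in> carrier (monoid_algebra M)"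
  shows "Poly_Mapping.single \<one>\<^bsub>M\<^esub> (- 1) \<otimes>\<^bsub>monoid_algebra M\<^esub> s = - s"
  using monoid_algebra_mult_add_left[where M = M and t = s and s = "Poly_Mapping.single \<one>\<^bsub>M\<^esub> (- 1)"
      and s' = "Poly_Mapping.single \<one>\<^bsub>M\<^esub> 1"] monoid_algebra_one_mult(1)[OF assms]
  by (simp add: eq_neg_iff_add_eq_0 flip: single_add)

text \<open>Closure under negation follows from absorption, since \<open>- s\<close> is the product
  of \<open>s\<close> with the scalar \<open>- 1\<close>.\<close>

lemma monoid_algebra_idealI:
  assumes M: "monoid M" and "I \<subseteq> carrier (monoid_algebra M)" and "0 \<in> I"
    and "\<And>s t. s \<in> I \<Longrightarrow> t \<in> I \<Longrightarrow> s + t \<in> I"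
    and l: "\<And>s t. s \<in> I \<Longrightarrow> t \<in> carrier (monoid_algebra M) \<Longrightarrow> t \<otimes>\<^bsub>monoid_algebra M\<^esub> s \<in> I"
    and "\<And>s t. s \<in> I \<Longrightarrow> t \<in> carrier (monoid_algebra M) \<Longrightarrow> s \<otimes>\<^bsub>monoid_algebra M\<^esub> t \<in> I"
  shows "ideal I (monoid_algebra M)"
proof (rule idealI)
  interpret ring "monoid_algebra M" using M by (rule monoid_algebra_ring)
  have neg: "- s \<in> I" if "s \<in> I" for s
    using l[OF that monoid_algebra_scalar_carrier[OF M, of "- 1"]] that assms(2)
      uminus_monoid_algebra[OF M, of s] by auto
  have "\<ominus>\<^bsub>monoid_algebra M\<^esub> s = - s" if "s \<in> I" for s
    using that neg assms(2) by (intro minus_equality) auto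
  with neg show "subgroup I (add_monoid (monoid_algebra M))"
    using assms by (intro subgroup.intro) (auto simp: a_inv_def)
qed (use assms monoid_algebra_ring in auto)

lemma monoid_algebra_ideal_diff:
  assumes "monoid M" "ideal I (monoid_algebra M)" "s \<in> I" "t \<in> I"
  shows "s - t \<in> I"
proof -
  interpret ideal I "monoid_algebra M" by fact
  have "- t \<in> I"
    using I_l_closed[OF assms(4) monoid_algebra_scalar_carrier[OF assms(1), of "- 1"]]
      uminus_monoid_algebra[OF assms(1)] assms(4) by simp
  then show ?thesis using additive_subgroup.a_closed[OF is_additive_subgroup assms(3), of "- t"] by simp
qed

lemma mem_monoid_algebra_coset: "t \<in> I +>\<^bsub>monoid_algebra M\<^esub> s \<longleftrightarrow> t - s \<in> I"
  by (auto simp: a_r_coset_def' intro: bexI[of _ "t - s"])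

lemma monoid_algebra_coset_eq_iff:
  assumes "monoid M" "ideal I (monoid_algebra M)"
  shows "I +>\<^bsub>monoid_algebra M\<^esub> s = I +>\<^bsub>monoid_algebra M\<^esub> t \<longleftrightarrow> s - t \<in> I"
proof
  interpret ideal I "monoid_algebra M" by fact
  have 0: "0 \<in> I" using additive_subgroup.zero_closed[OF is_additive_subgroup] by simp
  show "s - t \<in> I" if "I +>\<^bsub>monoid_algebra M\<^esub> s = I +>\<^bsub>monoid_algebra M\<^esub> t"
    using that mem_monoid_algebra_coset[where t = s and s = s and I = I and M = M] 0 by (simp add: mem_monoid_algebra_coset)
  assume st: "s - t \<in> I"
  have "u - t \<in> I \<longleftrightarrow> u - s \<in> I" for u
    using monoid_algebra_ideal_diff[OF assms _ st, of "u - t"] additive_subgroup.a_closed[OF is_additive_subgroup _ st, of "u - s"]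
    by auto
  then show "I +>\<^bsub>monoid_algebra M\<^esub> s = I +>\<^bsub>monoid_algebra M\<^esub> t"
    by (auto simp: mem_monoid_algebra_coset)
qed


section \<open>Linear extension of functions on a basis\<close>

definition linear_ext :: "('m \<Rightarrow> complex) \<Rightarrow> ('m \<Rightarrow>\<^sub>0 complex) \<Rightarrow> complex" where
  "linear_ext f t = (\<Sum>k\<in>Poly_Mapping.keys t. Poly_Mapping.lookup t k * f k)"

lemma linear_ext_superset:
  assumes "finite K" "Poly_Mapping.keys t \<subseteq> K"
  shows "linear_ext f t = (\<Sum>k\<in>K. Poly_Mapping.lookup t k * f k)"
  unfolding linear_ext_def using assms by (intro sum.mono_neutral_left) (auto simp: in_keys_iff)

lemma linear_ext_single [simp]: "linear_ext f (Poly_Mapping.single k c) = c * f k"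
  by (subst linear_ext_superset[of "{k}"]) auto

lemma linear_ext_zero [simp]: "linear_ext f 0 = 0"
  by (simp add: linear_ext_def)

lemma linear_ext_add [simp]: "linear_ext f (s + t) = linear_ext f s + linear_ext f t"
  using keys_add[of s t]
  by (simp add: linear_ext_superset[of "Poly_Mapping.keys s \<union> Poly_Mapping.keys t"] lookup_add
      distrib_right sum.distrib)

lemma linear_ext_diff [simp]: "linear_ext f (s - t) = linear_ext f s - linear_ext f t"
  using linear_ext_add[of f "s - t" t] by simp

lemma linear_ext_sum: "linear_ext f (\<Sum>i\<in>X. g i) = (\<Sum>i\<in>X. linear_ext f (g i))"
  by (induction X rule: infinite_finite_induct) auto

text \<open>Splitting one factor into basis elements expresses the value on a product through
  translates of \<open>f\<close>. This and its mirror image reduce absorption of a kernel under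
  multiplication to a translation property of the functionals.\<close>

lemma linear_ext_mult_left:
  "linear_ext f (s \<otimes>\<^bsub>monoid_algebra M\<^esub> t) = (\<Sum>k\<in>Poly_Mapping.keys s.
     Poly_Mapping.lookup s k * linear_ext (\<lambda>l. f (k \<otimes>\<^bsub>M\<^esub> l)) t)"
  by (simp add: monoid_algebra_def linear_ext_sum linear_ext_def[of _ t] sum_distrib_left mult.assoc)

lemma linear_ext_mult_right:
  "linear_ext f (s \<otimes>\<^bsub>monoid_algebra M\<^esub> t) = (\<Sum>l\<in>Poly_Mapping.keys t.
     Poly_Mapping.lookup t l * linear_ext (\<lambda>k. f (k \<otimes>\<^bsub>M\<^esub> l)) s)"
  unfolding linear_ext_mult_left linear_ext_def[of _ t] linear_ext_def[of _ s] sum_distrib_left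
  by (subst sum.swap) (simp add: mult_ac)


section \<open>Quotients of monoid algebras\<close>

text \<open>The laws under which multiplying both arguments of a bilinear functional by fixed
  elements keeps it bilinear. They are proved below for every quotient of a monoid algebra by an
  ideal.\<close>

locale complex_algebra = ring A for A :: "('a, 'x) star_alg_scheme" (structure) +
  assumes cscale_closed: "x \<in> carrier A \<Longrightarrow> cscale A c x \<in> carrier A"
    and cscale_mult_left: "x \<in> carrier A \<Longrightarrow> y \<in> carrier A \<Longrightarrow>
      cscale A c x \<otimes> y = cscale A c (x \<otimes> y)"
    and cscale_mult_right: "x \<in> carrier A \<Longrightarrow> y \<in> carrier A \<Longrightarrow>
      x \<otimes> cscale A c y = cscale A c (x \<otimes> y)"

lemma star_quotient_simps:
  "carrier (star_quotient M j I) = (\<lambda>s. I +>\<^bsub>monoid_algebra M\<^esub> s) ` carrier (monoid_algebra M)"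
  "x \<otimes>\<^bsub>star_quotient M j I\<^esub> y = [mod I:] x \<Otimes>\<^bsub>monoid_algebra M\<^esub> y"
  "\<one>\<^bsub>star_quotient M j I\<^esub> = I +>\<^bsub>monoid_algebra M\<^esub> Poly_Mapping.single \<one>\<^bsub>M\<^esub> 1"
  "\<zero>\<^bsub>star_quotient M j I\<^esub> = I"
  "x \<oplus>\<^bsub>star_quotient M j I\<^esub> y = x <+>\<^bsub>monoid_algebra M\<^esub> y"
  "cscale (star_quotient M j I) c x =
     [mod I:] (I +>\<^bsub>monoid_algebra M\<^esub> Poly_Mapping.single \<one>\<^bsub>M\<^esub> c) \<Otimes>\<^bsub>monoid_algebra M\<^esub> x"
  "star (star_quotient M j I) x = conj_extend j ` x"
  by (auto simp: star_quotient_def ring.extend_def star_alg.fields_def FactRing_def A_RCOSETS_def')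

lemma star_quotient_mult_coset:
  assumes "ideal I (monoid_algebra M)"
    and "s \<in> carrier (monoid_algebra M)" "t \<in> carrier (monoid_algebra M)"
  shows "(I +>\<^bsub>monoid_algebra M\<^esub> s) \<otimes>\<^bsub>star_quotient M j I\<^esub> (I +>\<^bsub>monoid_algebra M\<^esub> t) =
    I +>\<^bsub>monoid_algebra M\<^esub> (s \<otimes>\<^bsub>monoid_algebra M\<^esub> t)"
  using assms by (simp add: star_quotient_simps ideal.rcoset_mult_add)

lemma star_quotient_add_coset:
  assumes "ideal I (monoid_algebra M)"
    and "s \<in> carrier (monoid_algebra M)" "t \<in> carrier (monoid_algebra M)"
  shows "(I +>\<^bsub>monoid_algebra M\<^esub> s) \<oplus>\<^bsub>star_quotient M j I\<^esub> (I +>\<^bsub>monoid_algebra M\<^esub> t) =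
    I +>\<^bsub>monoid_algebra M\<^esub> (s + t)"
proof -
  interpret ideal I "monoid_algebra M" by fact
  show ?thesis using assms a_rcos_sum[of s t] by (simp add: star_quotient_simps)
qed

lemma star_quotient_cscale_coset:
  assumes "monoid M" "ideal I (monoid_algebra M)" "s \<in> carrier (monoid_algebra M)"
  shows "cscale (star_quotient M j I) c (I +>\<^bsub>monoid_algebra M\<^esub> s) =
    I +>\<^bsub>monoid_algebra M\<^esub> (Poly_Mapping.single \<one>\<^bsub>M\<^esub> c \<otimes>\<^bsub>monoid_algebra M\<^esub> s)"
  using assms by (simp add: star_quotient_simps ideal.rcoset_mult_add monoid_algebra_scalar_carrier)

lemma star_quotient_zero_coset:
  "\<zero>\<^bsub>star_quotient M j I\<^esub> = I +>\<^bsub>monoid_algebra M\<^esub> 0"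
  by (auto simp: star_quotient_simps mem_monoid_algebra_coset)

lemma star_quotient_complex_algebra:
  assumes M: "monoid M" and I: "ideal I (monoid_algebra M)"
  shows "complex_algebra (star_quotient M j I)"
proof -
  interpret F: ring "monoid_algebra M" using M by (rule monoid_algebra_ring)
  note coset = star_quotient_mult_coset[OF I] star_quotient_add_coset[OF I]
    star_quotient_cscale_coset[OF M I] star_quotient_zero_coset star_quotient_simps(1,3)
  have scalar: "Poly_Mapping.single \<one>\<^bsub>M\<^esub> c \<in> carrier (monoid_algebra M)" for c
    by (rule monoid_algebra_scalar_carrier[OF M])
  have closed: "s + t \<in> carrier (monoid_algebra M)"
    if "s \<in> carrier (monoid_algebra M)" "t \<in> carrier (monoid_algebra M)" for s t
    using F.a_closed[OF that] by simp
  have zero: "0 \<in> carrier (monoid_algebra M)" using F.zero_closed by simp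
  have "abelian_group (star_quotient M j I)"
  proof (rule abelian_groupI)
    fix x assume "x \<in> carrier (star_quotient M j I)"
    then obtain s where "x = I +>\<^bsub>monoid_algebra M\<^esub> s" "s \<in> carrier (monoid_algebra M)"
      by (auto simp: coset)
    moreover from this have "- s \<in> carrier (monoid_algebra M)"
      by (simp add: carrier_monoid_algebra)
    ultimately show "\<exists>y\<in>carrier (star_quotient M j I).
        y \<oplus>\<^bsub>star_quotient M j I\<^esub> x = \<zero>\<^bsub>star_quotient M j I\<^esub>"
      by (intro bexI[of _ "I +>\<^bsub>monoid_algebra M\<^esub> (- s)"]) (auto simp: coset)
  qed (use closed zero in \<open>auto simp: coset add_ac\<close>)
  moreover have "monoid (star_quotient M j I)"
    using scalar by (intro monoidI)
      (auto simp: coset F.m_assoc monoid_algebra_one_mult[OF M])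
  ultimately have "ring (star_quotient M j I)"
    using closed by (intro ringI)
      (auto simp: coset monoid_algebra_mult_add_left monoid_algebra_mult_add_right)
  \<comment> \<open>The scalar moves past \<open>s\<close> because multiples of the unit are
    central; this gives \<open>cscale_mult_right\<close>.\<close>
  moreover have "s \<otimes>\<^bsub>monoid_algebra M\<^esub> (Poly_Mapping.single \<one>\<^bsub>M\<^esub> c \<otimes>\<^bsub>monoid_algebra M\<^esub> t) =
      Poly_Mapping.single \<one>\<^bsub>M\<^esub> c \<otimes>\<^bsub>monoid_algebra M\<^esub> (s \<otimes>\<^bsub>monoid_algebra M\<^esub> t)"
    if "s \<in> carrier (monoid_algebra M)" "t \<in> carrier (monoid_algebra M)" for s t c
    using that scalar monoid_algebra_scalar_central[OF M that(1)]
    by (simp flip: F.m_assoc)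
  ultimately show ?thesis
    using scalar
    by (intro complex_algebra.intro complex_algebra_axioms.intro) (auto simp: coset F.m_assoc)
qed


section \<open>Functionals on tensor products\<close>

definition bilinear_functional ::
    "('a, 'x) star_alg_scheme \<Rightarrow> ('b, 'y) star_alg_scheme \<Rightarrow> ('a \<Rightarrow> 'b \<Rightarrow> complex) \<Rightarrow> bool" where
  "bilinear_functional A B f \<longleftrightarrow>
     (\<forall>y\<in>carrier B. linear_functional A (\<lambda>x. f x y)) \<and>
     (\<forall>x\<in>carrier A. linear_functional B (f x))"

lemma linear_ext_bilinear_relators:
  assumes "bilinear_functional A B f" "r \<in> bilinear_relators A B"
  shows "linear_ext (case_prod f) r = 0"
  using assms
  by (fastforce simp: bilinear_relators_def bilinear_functional_def linear_functional_def)

lemma bilinear_functional_translate: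
  assumes "complex_algebra A" "complex_algebra B" "bilinear_functional A B f"
    and "a \<in> carrier A" "b \<in> carrier B"
  shows "bilinear_functional A B (\<lambda>x y. f (a \<otimes>\<^bsub>A\<^esub> x) (b \<otimes>\<^bsub>B\<^esub> y))"
    and "bilinear_functional A B (\<lambda>x y. f (x \<otimes>\<^bsub>A\<^esub> a) (y \<otimes>\<^bsub>B\<^esub> b))"
proof -
  interpret A: complex_algebra A by fact
  interpret B: complex_algebra B by fact
  show "bilinear_functional A B (\<lambda>x y. f (a \<otimes>\<^bsub>A\<^esub> x) (b \<otimes>\<^bsub>B\<^esub> y))"
    "bilinear_functional A B (\<lambda>x y. f (x \<otimes>\<^bsub>A\<^esub> a) (y \<otimes>\<^bsub>B\<^esub> b))"
    using assms(3-5)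
    by (simp_all add: bilinear_functional_def linear_functional_def A.r_distr B.r_distr
        A.l_distr B.l_distr A.cscale_mult_left A.cscale_mult_right B.cscale_mult_left
        B.cscale_mult_right)
qed

lemma DirProd_algebra_monoid:
  assumes "complex_algebra A" "complex_algebra B"
  shows "monoid (A \<times>\<times> B)"
proof -
  interpret A: complex_algebra A by fact
  interpret B: complex_algebra B by fact
  show ?thesis by (intro DirProd_monoid A.monoid_axioms B.monoid_axioms)
qed

text \<open>Multiplying by a pair replaces \<open>f\<close> by a translate, so the kernel of one
  \<open>f\<close> need not be an ideal, while the common kernel of all bilinear functionals
  is.\<close>

lemma bilinear_kernel_ideal:
  assumes A: "complex_algebra A" and B: "complex_algebra B"
  shows "ideal {t \<in> carrier (monoid_algebra (A \<times>\<times> B)).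
      \<forall>f. bilinear_functional A B f \<longrightarrow> linear_ext (case_prod f) t = 0} (monoid_algebra (A \<times>\<times> B))"
    (is "ideal ?K ?F")
proof (rule monoid_algebra_idealI)
  show M: "monoid (A \<times>\<times> B)" using A B by (rule DirProd_algebra_monoid)
  interpret F: ring ?F using M by (rule monoid_algebra_ring)
  show "0 \<in> ?K" using F.zero_closed by simp
  show "s + t \<in> ?K" if "s \<in> ?K" "t \<in> ?K" for s t
    using that F.a_closed[of s t] by simp
  show "t \<otimes>\<^bsub>?F\<^esub> s \<in> ?K" if s: "s \<in> ?K" and t: "t \<in> carrier ?F" for s t
  proof -
    have "linear_ext (\<lambda>l. case_prod f (k \<otimes>\<^bsub>A \<times>\<times> B\<^esub> l)) s = 0"
      if "bilinear_functional A B f" "k \<in> Poly_Mapping.keys t" for f k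
    proof -
      have k: "fst k \<in> carrier A" "snd k \<in> carrier B"
        using that(2) t by (auto simp: carrier_monoid_algebra)
      have "linear_ext (case_prod (\<lambda>x y. f (fst k \<otimes>\<^bsub>A\<^esub> x) (snd k \<otimes>\<^bsub>B\<^esub> y))) s = 0"
        using s bilinear_functional_translate(1)[OF A B that(1) k] by blast
      then show ?thesis
        by (simp add: mult_DirProd' split_def)
    qed
    then show ?thesis using s t by (simp add: linear_ext_mult_left)
  qed
  show "s \<otimes>\<^bsub>?F\<^esub> t \<in> ?K" if s: "s \<in> ?K" and t: "t \<in> carrier ?F" for s t
  proof -
    have "linear_ext (\<lambda>l. case_prod f (l \<otimes>\<^bsub>A \<times>\<times> B\<^esub> k)) s = 0"
      if "bilinear_functional A B f" "k \<in> Poly_Mapping.keys t" for f k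
    proof -
      have k: "fst k \<in> carrier A" "snd k \<in> carrier B"
        using that(2) t by (auto simp: carrier_monoid_algebra)
      have "linear_ext (case_prod (\<lambda>x y. f (x \<otimes>\<^bsub>A\<^esub> fst k) (y \<otimes>\<^bsub>B\<^esub> snd k))) s = 0"
        using s bilinear_functional_translate(2)[OF A B that(1) k] by blast
      then show ?thesis
        by (simp add: mult_DirProd' split_def)
    qed
    then show ?thesis using s t by (simp add: linear_ext_mult_right)
  qed
qed auto

section \<open>The tensor ideal and its cosets\<close>

lemma bilinear_relators_carrier:
  assumes "complex_algebra A" "complex_algebra B"
  shows "bilinear_relators A B \<subseteq> carrier (monoid_algebra (A \<times>\<times> B))"
proof -
  interpret A: complex_algebra A by fact
  interpret B: complex_algebra B by fact
  interpret F: ring "monoid_algebra (A \<times>\<times> B)"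
    using assms by (intro monoid_algebra_ring DirProd_algebra_monoid)
  have pair: "formal_pair x y c \<in> carrier (monoid_algebra (A \<times>\<times> B))"
    if "x \<in> carrier A" "y \<in> carrier B" for x y c
    using that by (simp add: carrier_monoid_algebra)
  have diff: "s - t \<in> carrier (monoid_algebra (A \<times>\<times> B))"
    if "s \<in> carrier (monoid_algebra (A \<times>\<times> B))" "t \<in> carrier (monoid_algebra (A \<times>\<times> B))" for s t
    using that keys_diff[of s t] by (auto simp: carrier_monoid_algebra)
  show ?thesis
    unfolding bilinear_relators_def
    by (auto intro!: diff pair A.cscale_closed B.cscale_closed)
qed

lemma tensor_ideal_ideal:
  assumes "complex_algebra A" "complex_algebra B"
  shows "ideal (tensor_ideal A B) (monoid_algebra (A \<times>\<times> B))"
  unfolding tensor_ideal_def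
  using assms by (intro ring.genideal_ideal monoid_algebra_ring DirProd_algebra_monoid
      bilinear_relators_carrier)

text \<open>The common kernel is an ideal containing the relators, hence contains the ideal they
  generate. So every bilinear functional descends to the tensor product.\<close>

lemma linear_ext_tensor_ideal:
  assumes "complex_algebra A" "complex_algebra B" "bilinear_functional A B f"
    and "t \<in> tensor_ideal A B"
  shows "linear_ext (case_prod f) t = 0"
proof -
  have "tensor_ideal A B \<subseteq> {t \<in> carrier (monoid_algebra (A \<times>\<times> B)).
      \<forall>f. bilinear_functional A B f \<longrightarrow> linear_ext (case_prod f) t = 0}"
    unfolding tensor_ideal_def
    using assms(1,2) bilinear_relators_carrier[OF assms(1,2)]
    by (intro ring.genideal_minimal bilinear_kernel_ideal monoid_algebra_ring
        DirProd_algebra_monoid) (auto simp: linear_ext_bilinear_relators)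
  then show ?thesis using assms(3,4) by auto
qed

lemma formal_pairs_carrier:
  assumes "set ps \<subseteq> carrier A \<times> carrier B"
  shows "(\<Sum>(x, y)\<leftarrow>ps. formal_pair x y 1) \<in> carrier (monoid_algebra (A \<times>\<times> B))"
  using assms
proof (induction ps)
  case (Cons p ps)
  then show ?case
    using keys_add[of "formal_pair (fst p) (snd p) 1" "\<Sum>(x, y)\<leftarrow>ps. formal_pair x y 1"]
    by (auto simp: carrier_monoid_algebra split_def)
qed (simp add: carrier_monoid_algebra)

lemma tensor_sum_coset:
  assumes "complex_algebra A" "set ps \<subseteq> carrier A \<times> carrier A"
  shows "tensor_sum A ps =
    tensor_ideal A A +>\<^bsub>monoid_algebra (A \<times>\<times> A)\<^esub> (\<Sum>(x, y)\<leftarrow>ps. formal_pair x y 1)"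
  using assms(2)
proof (induction ps)
  case Nil
  show ?case
    by (simp add: tensor_sum_def tensor_alg_def star_quotient_zero_coset)
next
  case (Cons p ps)
  have "formal_pair (fst p) (snd p) 1 \<in> carrier (monoid_algebra (A \<times>\<times> A))"
    using Cons.prems by (auto simp: carrier_monoid_algebra)
  moreover have "(\<Sum>(x, y)\<leftarrow>ps. formal_pair x y 1) \<in> carrier (monoid_algebra (A \<times>\<times> A))"
    using Cons.prems by (intro formal_pairs_carrier) auto
  ultimately show ?case
    using Cons by (simp add: tensor_sum_def tensor_alg_def pure_tensor_def split_def
        star_quotient_add_coset[OF tensor_ideal_ideal[OF assms(1) assms(1)]])
qed

lemma linear_ext_formal_pairs:
  "linear_ext (case_prod f) (\<Sum>(x, y)\<leftarrow>ps. formal_pair x y 1) = (\<Sum>(x, y)\<leftarrow>ps. f x y)"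
  by (induction ps) auto

text \<open>\<open>sweedler\<close> picks an unspecified decomposition. Two decompositions of
  \<open>\<Delta> a\<close> differ by an element of the tensor ideal, which the bilinear functional
  \<open>\<phi> [x] * \<psi> y\<close> kills, so any convenient decomposition may be used
  instead.\<close>

lemma convolution_one_argument:
  assumes A: "complex_algebra A" and \<phi>: "multilinear A 1 \<phi>" and \<psi>: "linear_functional A \<psi>"
    and ps: "set ps \<subseteq> carrier A \<times> carrier A" "tensor_sum A ps = \<Delta> a"
  shows "convolution A \<Delta> \<phi> \<psi> [a] = (\<Sum>(x, y)\<leftarrow>ps. \<phi> [x] * \<psi> y)"
proof -
  interpret complex_algebra A by fact
  let ?qs = "sweedler A \<Delta> a"
  let ?f = "\<lambda>x y. \<phi> [x] * \<psi> y"
  have qs: "set ?qs \<subseteq> carrier A \<times> carrier A" "tensor_sum A ?qs = \<Delta> a"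
    unfolding sweedler_def using someI[of "\<lambda>ps. set ps \<subseteq> carrier A \<times> carrier A \<and> tensor_sum A ps = \<Delta> a" ps] ps
    by auto
  \<comment> \<open>The entry \<open>\<zero>\<close> is a placeholder that the update overwrites; it
    only supplies an argument list of length one.\<close>
  have "linear_functional A (\<lambda>x. \<phi> ([\<zero>\<^bsub>A\<^esub>][0 := x]))"
    using \<phi> unfolding multilinear_def arg_lists_def by fastforce
  then have f: "bilinear_functional A A ?f"
    using \<psi> by (simp add: bilinear_functional_def linear_functional_def algebra_simps)
  have "tensor_ideal A A +>\<^bsub>monoid_algebra (A \<times>\<times> A)\<^esub> (\<Sum>(x, y)\<leftarrow>?qs. formal_pair x y 1) =
      tensor_ideal A A +>\<^bsub>monoid_algebra (A \<times>\<times> A)\<^esub> (\<Sum>(x, y)\<leftarrow>ps. formal_pair x y 1)"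
    using qs ps tensor_sum_coset[OF A] by metis
  then have "(\<Sum>(x, y)\<leftarrow>?qs. formal_pair x y 1) - (\<Sum>(x, y)\<leftarrow>ps. formal_pair x y 1) \<in> tensor_ideal A A"
    using monoid_algebra_coset_eq_iff[OF DirProd_algebra_monoid tensor_ideal_ideal] A by blast
  from linear_ext_tensor_ideal[OF A A f this]
  have "(\<Sum>(x, y)\<leftarrow>?qs. ?f x y) = (\<Sum>(x, y)\<leftarrow>ps. ?f x y)"
    by (simp add: linear_ext_formal_pairs)
  \<comment> \<open>\<open>list_mult\<close> ends with the unit, even on a single factor.\<close>
  moreover have r_one_qs: "y \<otimes>\<^bsub>A\<^esub> \<one>\<^bsub>A\<^esub> = y" if "(x, y) \<in> set ?qs" for x y
    using that qs(1) by (intro r_one) auto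
  moreover have "convolution A \<Delta> \<phi> \<psi> [a] = (\<Sum>(x, y)\<leftarrow>?qs. ?f x y)"
    using r_one_qs unfolding convolution_def
    by (auto simp: list_mult_def o_def split_def map_concat intro!: arg_cong[of _ _ sum_list])
  ultimately show ?thesis by simp
qed


section \<open>Involutions\<close>

lemma conj_extend_superset:
  assumes "finite K" "Poly_Mapping.keys t \<subseteq> K"
  shows "conj_extend j t =
    (\<Sum>k\<in>K. Poly_Mapping.single (j k) (cnj (Poly_Mapping.lookup t k)))"
  unfolding conj_extend_def using assms
  by (intro sum.mono_neutral_left) (auto simp: in_keys_iff)

lemma conj_extend_add [simp]: "conj_extend j (s + t) = conj_extend j s + conj_extend j t"
  using keys_add[of s t]
  by (simp add: conj_extend_superset[of "Poly_Mapping.keys s \<union> Poly_Mapping.keys t"] lookup_add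
      single_add sum.distrib)

lemma conj_extend_diff [simp]: "conj_extend j (s - t) = conj_extend j s - conj_extend j t"
  using conj_extend_add[of j "s - t" t] by (simp add: eq_diff_eq del: conj_extend_add)

lemma conj_extend_single [simp]:
  "conj_extend j (Poly_Mapping.single k c) = Poly_Mapping.single (j k) (cnj c)"
  by (subst conj_extend_superset[of "{k}"]) auto

lemma conj_extend_zero [simp]: "conj_extend j 0 = 0"
  by (simp add: conj_extend_def)

lemma conj_extend_sum: "conj_extend j (\<Sum>i\<in>X. f i) = (\<Sum>i\<in>X. conj_extend j (f i))"
  by (induction X rule: infinite_finite_induct) auto

lemma conj_extend_mult:
  assumes "\<And>k l. j (k \<otimes>\<^bsub>M\<^esub> l) = j l \<otimes>\<^bsub>M\<^esub> j k"
  shows "conj_extend j (s \<otimes>\<^bsub>monoid_algebra M\<^esub> t) =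
    conj_extend j t \<otimes>\<^bsub>monoid_algebra M\<^esub> conj_extend j s"
proof -
  have "conj_extend j (s \<otimes>\<^bsub>monoid_algebra M\<^esub> t) =
      (\<Sum>k\<in>Poly_Mapping.keys s. \<Sum>l\<in>Poly_Mapping.keys t. Poly_Mapping.single (j l \<otimes>\<^bsub>M\<^esub> j k)
        (cnj (Poly_Mapping.lookup t l) * cnj (Poly_Mapping.lookup s k)))"
    by (simp add: monoid_algebra_def conj_extend_sum assms mult.commute)
  then show ?thesis
    by (simp add: conj_extend_def monoid_algebra_mult_sum_left monoid_algebra_mult_sum_right)
qed

lemma conj_extend_involution:
  assumes "\<And>k. j (j k) = k"
  shows "conj_extend j (conj_extend j t) = t"
proof -
  have "conj_extend j (conj_extend j t) =
      (\<Sum>k\<in>Poly_Mapping.keys t. Poly_Mapping.single k (Poly_Mapping.lookup t k))"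
    unfolding conj_extend_def[of j t] by (simp add: conj_extend_sum assms)
  then show ?thesis by (simp flip: poly_mapping_eq_sum_single)
qed


section \<open>Computing in \<open>SU\<^sub>q(2)\<close>\<close>

lemma word_monoid_simps [simp]:
  "carrier word_monoid = UNIV" "u \<otimes>\<^bsub>word_monoid\<^esub> v = u @ v" "\<one>\<^bsub>word_monoid\<^esub> = []"
  by (simp_all add: word_monoid_def)

lemma monoid_word_monoid: "monoid word_monoid"
  by (rule monoidI) auto

lemma free_algebra_carrier [simp]: "t \<in> carrier (monoid_algebra word_monoid)"
  by (simp add: carrier_monoid_algebra)

lemma word_star_mult: "word_star (u \<otimes>\<^bsub>word_monoid\<^esub> v) = word_star v \<otimes>\<^bsub>word_monoid\<^esub> word_star u"
  by (simp add: word_star_def)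

lemma word_star_involution: "word_star (word_star w) = w"
proof -
  have "letter_star (letter_star l) = l" for l by (cases l) auto
  then show ?thesis by (simp add: word_star_def rev_map o_def)
qed

lemma SUq2_ideal_ideal: "ideal (SUq2_ideal q) (monoid_algebra word_monoid)"
  unfolding SUq2_ideal_def
  by (intro ring.genideal_ideal monoid_algebra_ring monoid_word_monoid) auto

lemma SUq2_relators_subset:
  "SUq2_relators q \<union> conj_extend word_star ` SUq2_relators q \<subseteq> SUq2_ideal q"
  unfolding SUq2_ideal_def
  by (intro ring.genideal_self monoid_algebra_ring monoid_word_monoid) auto

lemma SUq2_ideal_minimal:
  assumes "ideal J (monoid_algebra word_monoid)"
    and "SUq2_relators q \<union> conj_extend word_star ` SUq2_relators q \<subseteq> J"
  shows "SUq2_ideal q \<subseteq> J"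
  unfolding SUq2_ideal_def
  using assms by (intro ring.genideal_minimal monoid_algebra_ring monoid_word_monoid)

text \<open>The preimage of the ideal under the involution is again an ideal, with left and right
  absorption exchanged, and it contains the generators because the generating set is closed under
  the involution.\<close>

lemma SUq2_ideal_star:
  assumes "t \<in> SUq2_ideal q"
  shows "conj_extend word_star t \<in> SUq2_ideal q"
proof -
  interpret I: ideal "SUq2_ideal q" "monoid_algebra word_monoid" by (rule SUq2_ideal_ideal)
  note mult = conj_extend_mult[where M = word_monoid, OF word_star_mult]
  have "ideal {t. conj_extend word_star t \<in> SUq2_ideal q} (monoid_algebra word_monoid)"
    using additive_subgroup.a_closed[OF I.is_additive_subgroup]
      additive_subgroup.zero_closed[OF I.is_additive_subgroup]
    by (intro monoid_algebra_idealI monoid_word_monoid)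
      (auto simp: mult I.I_l_closed I.I_r_closed)
  moreover have "SUq2_relators q \<union> conj_extend word_star ` SUq2_relators q \<subseteq>
      {t. conj_extend word_star t \<in> SUq2_ideal q}"
    using SUq2_relators_subset[of q]
    by (auto simp: conj_extend_involution word_star_involution)
  ultimately show ?thesis using SUq2_ideal_minimal assms by blast
qed

section \<open>Classes of words, and linear functionals in terms of them\<close>

lemma SUq2_complex_algebra: "complex_algebra (SUq2 q)"
  unfolding SUq2_def by (rule star_quotient_complex_algebra[OF monoid_word_monoid SUq2_ideal_ideal])

abbreviation suq2_coset :: "real \<Rightarrow> (letter list \<Rightarrow>\<^sub>0 complex) \<Rightarrow> suq2" where
  "suq2_coset q t \<equiv> SUq2_ideal q +>\<^bsub>monoid_algebra word_monoid\<^esub> t"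

definition suq2_word :: "real \<Rightarrow> letter list \<Rightarrow> suq2" where
  "suq2_word q w = suq2_coset q (free_word w 1)"

text \<open>\<open>star\<close> is the image of a coset as a set. Invariance of the ideal puts this
  image inside one coset, and involutivity makes it all of that coset.\<close>

lemma SUq2_star_coset: "star (SUq2 q) (suq2_coset q t) = suq2_coset q (conj_extend word_star t)"
proof -
  note invol = conj_extend_involution[of word_star, OF word_star_involution]
  have "s \<in> conj_extend word_star ` suq2_coset q t"
    if "s - conj_extend word_star t \<in> SUq2_ideal q" for s
    using SUq2_ideal_star[OF that]
    by (intro image_eqI[of _ _ "conj_extend word_star s"])
      (simp_all add: invol mem_monoid_algebra_coset)
  then show ?thesis
    using SUq2_ideal_star[of _ q]
    by (force simp: SUq2_def star_quotient_simps mem_monoid_algebra_coset simp flip: conj_extend_diff)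
qed

lemma suq2_word_simps [simp]:
  "suq2_word q u \<otimes>\<^bsub>SUq2 q\<^esub> suq2_word q v = suq2_word q (u @ v)"
  "star (SUq2 q) (suq2_word q u) = suq2_word q (word_star u)"
  "suq2_word q u \<in> carrier (SUq2 q)"
  unfolding suq2_word_def SUq2_star_coset
  by (simp_all add: SUq2_def star_quotient_mult_coset[OF SUq2_ideal_ideal] star_quotient_simps(1))

lemma SUq2_one: "\<one>\<^bsub>SUq2 q\<^esub> = suq2_word q []"
  by (simp add: SUq2_def star_quotient_simps suq2_word_def)

lemma linear_functional_coset:
  assumes "linear_functional (SUq2 q) \<tau>"
  shows "\<tau> (suq2_coset q t) = linear_ext (\<lambda>w. \<tau> (suq2_word q w)) t"
proof -
  have carrier: "suq2_coset q s \<in> carrier (SUq2 q)" for s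
    by (simp add: SUq2_def star_quotient_simps)
  have add: "\<tau> (suq2_coset q (s + t)) = \<tau> (suq2_coset q s) + \<tau> (suq2_coset q t)" for s t
  proof -
    have "suq2_coset q s \<oplus>\<^bsub>SUq2 q\<^esub> suq2_coset q t = suq2_coset q (s + t)"
      by (simp add: SUq2_def star_quotient_add_coset[OF SUq2_ideal_ideal])
    then show ?thesis using assms carrier by (metis linear_functional_def)
  qed
  have single: "\<tau> (suq2_coset q (free_word w c)) = c * \<tau> (suq2_word q w)" for w c
  proof -
    have "cscale (SUq2 q) c (suq2_word q w) = suq2_coset q (free_word w c)"
      by (simp add: SUq2_def suq2_word_def
          star_quotient_cscale_coset[OF monoid_word_monoid SUq2_ideal_ideal])
    then show ?thesis using assms suq2_word_simps(3) by (metis linear_functional_def)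
  qed
  have zero: "\<tau> (suq2_coset q 0) = 0"
    using add[of 0 0] by simp
  have "\<tau> (suq2_coset q (\<Sum>w\<in>K. free_word w (Poly_Mapping.lookup t w))) =
      (\<Sum>w\<in>K. Poly_Mapping.lookup t w * \<tau> (suq2_word q w))" for K
    by (induction K rule: infinite_finite_induct) (auto simp: add single zero)
  from this[of "Poly_Mapping.keys t"] show ?thesis
    by (simp add: linear_ext_def flip: poly_mapping_eq_sum_single)
qed

text \<open>A relator has the zero class, so each defining relation becomes a linear equation
  between the values of \<open>\<tau>\<close> on words.\<close>

lemma linear_functional_relator:
  assumes "linear_functional (SUq2 q) \<tau>" "r \<in> SUq2_relators q \<union> conj_extend word_star ` SUq2_relators q"
  shows "linear_ext (\<lambda>w. \<tau> (suq2_word q w)) r = 0"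
proof -
  have "suq2_coset q r = suq2_coset q 0"
    using assms(2) SUq2_relators_subset[of q]
    by (auto simp: monoid_algebra_coset_eq_iff[OF monoid_word_monoid SUq2_ideal_ideal])
  then show ?thesis
    using linear_functional_coset[OF assms(1), of r] linear_functional_coset[OF assms(1), of 0] by simp
qed


section \<open>A representation detecting \<open>\<beta>\<beta>\<^sup>*\<close>\<close>

text \<open>The basis is rescaled to avoid the weights \<open>sqrt (1 - q ^ (2 * n))\<close>, at the price of the star property.\<close>

fun letter_op :: "real \<Rightarrow> letter \<Rightarrow> (nat \<Rightarrow> complex) \<Rightarrow> nat \<Rightarrow> complex" where
  "letter_op q La f n = of_real (1 - q ^ (2 * n + 2)) * f (Suc n)"
| "letter_op q Las f n = (case n of 0 \<Rightarrow> 0 | Suc m \<Rightarrow> f m)"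
| "letter_op q Lb f n = of_real (q ^ n) * f n"
| "letter_op q Lbs f n = of_real (q ^ n) * f n"

lemma letter_op_sum:
  "letter_op q l (\<lambda>n. \<Sum>i\<in>X. c i * g i n) n = (\<Sum>i\<in>X. c i * letter_op q l (g i) n)"
  by (cases l) (simp_all add: sum_distrib_left mult.left_commute split: nat.split)

lemma word_op_linear_ext:
  "foldr (letter_op q) k (\<lambda>n. linear_ext (\<lambda>w. g w n) t) n =
     linear_ext (\<lambda>w. foldr (letter_op q) k (g w) n) t"
proof (induction k arbitrary: n)
  case (Cons l k)
  then have "foldr (letter_op q) k (\<lambda>n. linear_ext (\<lambda>w. g w n) t) =
      (\<lambda>n. linear_ext (\<lambda>w. foldr (letter_op q) k (g w) n) t)" by blast
  then show ?case by (simp add: linear_ext_def letter_op_sum)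
qed simp

text \<open>A right factor only replaces \<open>f\<close> by another function, which is why all
  \<open>f\<close> are quantified. A left factor applies a linear operator to a function of
  \<open>n\<close> that vanishes everywhere, which is why all \<open>n\<close> are.\<close>

lemma word_op_kernel_ideal:
  "ideal {t. \<forall>f n. linear_ext (\<lambda>w. foldr (letter_op q) w f n) t = 0} (monoid_algebra word_monoid)"
    (is "ideal ?K _")
proof (rule monoid_algebra_idealI[OF monoid_word_monoid])
  show "s \<otimes>\<^bsub>monoid_algebra word_monoid\<^esub> t \<in> ?K" if "s \<in> ?K" for s t
    using that by (simp add: linear_ext_mult_right)
  show "t \<otimes>\<^bsub>monoid_algebra word_monoid\<^esub> s \<in> ?K" if s: "s \<in> ?K" for s t
  proof -
    have "foldr (letter_op q) k (\<lambda>n. 0) n = 0" for k n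
      using word_op_linear_ext[of q k "\<lambda>_ _. 0" 0 n] by simp
    moreover have "linear_ext (\<lambda>w. foldr (letter_op q) k (foldr (letter_op q) w f) n) s =
        foldr (letter_op q) k (\<lambda>n. linear_ext (\<lambda>w. foldr (letter_op q) w f n) s) n" for k f n
      by (rule word_op_linear_ext[symmetric])
    ultimately show ?thesis using s by (simp add: linear_ext_mult_left)
  qed
qed auto

text \<open>The relations hold pointwise. At \<open>n = 0\<close> the operator of \<open>Las\<close>
  gives \<open>0\<close> and that of \<open>Lb\<close> has weight \<open>q ^ 0 = 1\<close>, so the
  first relation survives the boundary. The starred relators need their own check, as the rescaling
  gives up the star property.\<close>

lemma word_op_relators:
  assumes "r \<in> SUq2_relators q \<union> conj_extend word_star ` SUq2_relators q"
  shows "linear_ext (\<lambda>w. foldr (letter_op q) w f n) r = 0"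
  using assms
  by (auto simp: SUq2_relators_def word_star_def)
    (auto simp: algebra_simps power_mult power2_eq_square split: nat.split)

lemma exists_functional_beta:
  "\<exists>\<psi>. linear_functional (SUq2 q) \<psi> \<and> \<psi> (suq2_word q [Lb, Lbs]) = 1"
proof -
  \<comment> \<open>The functional is the matrix coefficient at the lowest basis vector:
    \<open>\<beta>\<close> and its adjoint act there with weight \<open>q ^ 0 = 1\<close>, so its
    value on their product is \<open>1\<close>.\<close>
  define e :: "nat \<Rightarrow> complex" where "e n = (if n = 0 then 1 else 0)" for n
  define f where "f t = linear_ext (\<lambda>w. foldr (letter_op q) w e 0) t" for t
  \<comment> \<open>A coset is evaluated at an arbitrary representative; this is well defined
    because \<open>f\<close> vanishes on the ideal.\<close>
  define \<psi> where "\<psi> X = f (SOME t. t \<in> X)" for X :: suq2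
  have kernel: "f t = 0" if "t \<in> SUq2_ideal q" for t
    using SUq2_ideal_minimal[OF word_op_kernel_ideal, of q q] word_op_relators that
    unfolding f_def by blast
  have "t \<in> suq2_coset q t" for t
    using additive_subgroup.zero_closed[OF ideal.axioms(1)[OF SUq2_ideal_ideal]]
    by (simp add: mem_monoid_algebra_coset)
  then have "(SOME s. s \<in> suq2_coset q t) - t \<in> SUq2_ideal q" for t
    by (metis mem_monoid_algebra_coset someI)
  then have \<psi>: "\<psi> (suq2_coset q t) = f t" for t
    using kernel unfolding \<psi>_def f_def by (metis linear_ext_diff eq_iff_diff_eq_0)
  \<comment> \<open>Scaling in the quotient is left multiplication by \<open>free_word [] c\<close>.
    For \<open>c = 0\<close> this element has no keys, hence the case distinction.\<close>
  have "f (free_word [] c \<otimes>\<^bsub>monoid_algebra word_monoid\<^esub> t) = c * f t" for c t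
    unfolding f_def linear_ext_mult_left by (cases "c = 0") auto
  then have "linear_functional (SUq2 q) \<psi>"
    unfolding linear_functional_def
    by (auto simp: SUq2_def star_quotient_simps(1) star_quotient_add_coset[OF SUq2_ideal_ideal]
        star_quotient_cscale_coset[OF monoid_word_monoid SUq2_ideal_ideal] \<psi>)
      (simp add: f_def)
  moreover have "\<psi> (suq2_word q [Lb, Lbs]) = 1"
    by (simp add: suq2_word_def \<psi> f_def e_def)
  ultimately show ?thesis by blast
qed


section \<open>Invariant traces\<close>

lemma trace_word_values:
  assumes "trace_functional (SUq2 q) \<tau>" "0 < q" "q < 1"
  shows "\<tau> (suq2_word q [Lb, Lbs]) = 0" "\<tau> (suq2_word q [Lb, La]) = 0"
    "\<tau> (suq2_word q [Las, Lbs]) = 0" "\<tau> (suq2_word q [Las, La]) = \<tau> \<one>\<^bsub>SUq2 q\<^esub>"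
proof -
  let ?t = "\<lambda>w. \<tau> (suq2_word q w)"
  have lin: "linear_functional (SUq2 q) \<tau>" using assms(1) by (simp add: trace_functional_def)
  have trace: "?t (u @ v) = ?t (v @ u)" for u v
  proof -
    have "\<tau> (suq2_word q u \<otimes>\<^bsub>SUq2 q\<^esub> suq2_word q v) = \<tau> (suq2_word q v \<otimes>\<^bsub>SUq2 q\<^esub> suq2_word q u)"
      using assms(1) unfolding trace_functional_def by (blast intro: suq2_word_simps(3))
    then show ?thesis by simp
  qed
  note swap = trace[of "[_]" "[_]", simplified]
  note rel = linear_functional_relator[OF lin]
  have 1: "?t [Las, La] + ?t [Lbs, Lb] - ?t [] = 0"
    using rel[of "free_word [Las, La] 1 + free_word [Lbs, Lb] 1 - free_word [] 1"]
    by (simp add: SUq2_relators_def)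
  have 2: "?t [La, Las] + of_real (q\<^sup>2) * ?t [Lb, Lbs] - ?t [] = 0"
    using rel[of "free_word [La, Las] 1 + free_word [Lb, Lbs] (of_real (q\<^sup>2)) - free_word [] 1"]
    by (simp add: SUq2_relators_def)
  have 3: "?t [La, Lb] - of_real q * ?t [Lb, La] = 0"
    using rel[of "free_word [La, Lb] 1 - free_word [Lb, La] (of_real q)"]
    by (simp add: SUq2_relators_def)
  \<comment> \<open>The relation for \<open>[Las, Lbs]\<close> is the adjoint of the third relator,
    so it comes from the starred half of the generators.\<close>
  have "conj_extend word_star (free_word [La, Lb] 1 - free_word [Lb, La] (of_real q)) \<in>
      SUq2_relators q \<union> conj_extend word_star ` SUq2_relators q"
    by (simp add: SUq2_relators_def del: conj_extend_diff conj_extend_single)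
  from rel[OF this] have 4: "?t [Lbs, Las] - of_real q * ?t [Las, Lbs] = 0"
    by (simp add: word_star_def)
  \<comment> \<open>Here \<open>0 < q < 1\<close> enters: \<open>1 - q\<close> and
    \<open>1 - q\<^sup>2\<close> can be cancelled below.\<close>
  have q: "of_real q \<noteq> (1 :: complex)" "of_real (q\<^sup>2) \<noteq> (1 :: complex)"
    using assms(2,3) power2_eq_1_iff[of q] by (auto simp flip: of_real_power)
  \<comment> \<open>Difference of the first two relations: cyclicity cancels the terms in
    \<open>[Las, La]\<close> and \<open>[La, Las]\<close> and merges those in
    \<open>[Lb, Lbs]\<close> and \<open>[Lbs, Lb]\<close>.\<close>
  have "(1 - of_real (q\<^sup>2)) * ?t [Lb, Lbs] =
      (?t [Las, La] + ?t [Lbs, Lb] - ?t []) - (?t [La, Las] + of_real (q\<^sup>2) * ?t [Lb, Lbs] - ?t [])"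
    using swap[of La Las] swap[of Lb Lbs] by (simp add: algebra_simps)
  then have "(1 - of_real (q\<^sup>2)) * ?t [Lb, Lbs] = 0"
    unfolding 1 2 by simp
  then show b: "?t [Lb, Lbs] = 0" using q by simp
  show "?t [Las, La] = \<tau> \<one>\<^bsub>SUq2 q\<^esub>" using 1 b swap[of Lb Lbs] by (simp add: SUq2_one)
  have "(1 - of_real q) * ?t [Lb, La] = 0"
    using 3 swap[of La Lb] by (simp add: algebra_simps)
  then show "?t [Lb, La] = 0" using q by simp
  have "(1 - of_real q) * ?t [Las, Lbs] = 0"
    using 4 swap[of Las Lbs] by (simp add: algebra_simps)
  then show "?t [Las, Lbs] = 0" using q by simp
qed

text \<open>The four terms arise by multiplying \<open>\<beta> \<otimes> \<alpha> + \<alpha>\<^sup>*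
  \<otimes> \<beta>\<close>, the coproduct of \<open>\<beta>\<close>, with its adjoint
  \<open>\<beta>\<^sup>* \<otimes> \<alpha>\<^sup>* + \<alpha> \<otimes>
  \<beta>\<^sup>*\<close>.\<close>

lemma coproduct_beta_beta_star:
  assumes "is_SUq2_coproduct q \<Delta>"
  shows "tensor_sum (SUq2 q)
      [(suq2_word q [Lb, Lbs], suq2_word q [La, Las]), (suq2_word q [Lb, La], suq2_word q [La, Lbs]),
       (suq2_word q [Las, Lbs], suq2_word q [Lb, Las]), (suq2_word q [Las, La], suq2_word q [Lb, Lbs])] =
    \<Delta> (suq2_word q [Lb, Lbs])"
proof -
  define A where "A = SUq2 q"
  define J where "J = tensor_ideal A A"
  define F where "F = monoid_algebra (A \<times>\<times> A)"
  define T where "T = tensor_alg A A"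
  define w where "w = suq2_word q"
  have A: "complex_algebra A" unfolding A_def by (rule SUq2_complex_algebra)
  have M: "monoid (A \<times>\<times> A)" by (intro DirProd_algebra_monoid A)
  have J: "ideal J F" unfolding J_def F_def by (intro tensor_ideal_ideal A)
  have pair: "formal_pair (w u) (w v) 1 \<in> carrier F" for u v
    by (simp add: F_def carrier_monoid_algebra w_def A_def)
  have plus: "s + t \<in> carrier F" if "s \<in> carrier F" "t \<in> carrier F" for s t
    using that keys_add[of s t] by (auto simp: F_def carrier_monoid_algebra)
  have pure: "pure_tensor A A x y = J +>\<^bsub>F\<^esub> formal_pair x y 1" for x y
    by (simp add: pure_tensor_def J_def F_def)
  have add_coset: "(J +>\<^bsub>F\<^esub> s) \<oplus>\<^bsub>T\<^esub> (J +>\<^bsub>F\<^esub> t) = J +>\<^bsub>F\<^esub> (s + t)"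
    and mult_coset: "(J +>\<^bsub>F\<^esub> s) \<otimes>\<^bsub>T\<^esub> (J +>\<^bsub>F\<^esub> t) = J +>\<^bsub>F\<^esub> (s \<otimes>\<^bsub>F\<^esub> t)"
    if "s \<in> carrier F" "t \<in> carrier F" for s t
    using that J star_quotient_add_coset star_quotient_mult_coset
    unfolding T_def tensor_alg_def J_def F_def by blast+
  have starw: "star A (w [Lb]) = w [Lbs]" "star A (w [La]) = w [Las]"
    by (simp_all add: A_def w_def word_star_def)
  let ?b = "formal_pair (w [Lb]) (w [La]) 1 + formal_pair (w [Las]) (w [Lb]) 1"
  let ?b' = "formal_pair (w [Lbs]) (w [Las]) 1 + formal_pair (w [La]) (w [Lbs]) 1"
  have hom: "\<Delta> \<in> star_alg_hom A T"
    and "\<Delta> (w [Lb]) = pure_tensor A A (w [Lb]) (w [La]) \<oplus>\<^bsub>T\<^esub>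
      pure_tensor A A (star A (w [La])) (w [Lb])"
    using assms by (simp_all add: is_SUq2_coproduct_def Let_def A_def T_def w_def suq2_word_def
        suq2_alpha_def suq2_beta_def)
  then have b: "\<Delta> (w [Lb]) = J +>\<^bsub>F\<^esub> ?b"
    by (simp add: pure starw(2) add_coset pair)
  have carrier: "w [Lb] \<in> carrier A" "w [Lbs] \<in> carrier A"
    by (simp_all add: A_def w_def)
  have star: "\<Delta> (w [Lbs]) = star T (\<Delta> (w [Lb]))" "\<Delta> (w [Lbs]) \<in> carrier T"
    using hom carrier by (auto simp add: star_alg_hom_def ring_hom_def Pi_iff simp flip: starw)
  \<comment> \<open>\<open>star\<close> acts on the coset as a set, so the adjoint is computed on
    the representative \<open>?b\<close>: its conjugate is a member of the coset sought.\<close>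
  have "?b \<in> J +>\<^bsub>F\<^esub> ?b"
    using additive_subgroup.zero_closed[OF ideal.axioms(1)[OF J]]
    by (simp add: mem_monoid_algebra_coset F_def)
  then have "conj_extend (map_prod (star A) (star A)) ?b \<in> \<Delta> (w [Lbs])"
    unfolding star b T_def tensor_alg_def star_quotient_simps by (rule imageI)
  then have mem: "?b' \<in> \<Delta> (w [Lbs])"
    by (simp add: A_def w_def word_star_def)
  \<comment> \<open>That \<open>\<Delta>(\<beta>\<^sup>*)\<close> is a coset comes from \<open>\<Delta>\<close> mapping into the carrier, so the tensor ideal need not
      be known to be star-closed.\<close>
  obtain s where s: "\<Delta> (w [Lbs]) = J +>\<^bsub>F\<^esub> s"
    using star(2) by (auto simp: T_def tensor_alg_def star_quotient_simps J_def F_def)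
  with mem have "?b' - s \<in> J" by (simp add: mem_monoid_algebra_coset F_def)
  then have b': "\<Delta> (w [Lbs]) = J +>\<^bsub>F\<^esub> ?b'"
    using monoid_algebra_coset_eq_iff[OF M J[unfolded F_def], of ?b' s] s by (simp add: F_def)
  have "\<Delta> (w [Lb] \<otimes>\<^bsub>A\<^esub> w [Lbs]) = \<Delta> (w [Lb]) \<otimes>\<^bsub>T\<^esub> \<Delta> (w [Lbs])"
    using hom carrier by (intro ring_hom_mult) (simp_all add: star_alg_hom_def)
  also have "\<dots> = J +>\<^bsub>F\<^esub> (?b \<otimes>\<^bsub>F\<^esub> ?b')"
    by (simp add: b b' mult_coset pair plus)
  finally show ?thesis
    by (subst tensor_sum_coset[OF SUq2_complex_algebra])
      (auto simp: A_def w_def F_def J_def monoid_algebra_mult_add_left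
        monoid_algebra_mult_add_right add_ac)
qed

text \<open>\<open>\<phi>\<close> belongs to its own class, hence to that of \<open>\<psi>\<close>,
  and a coboundary in degree \<open>0\<close> vanishes.\<close>

lemma HC_class_zero_eqD:
  assumes "cyclic_cocycle A 0 \<phi>" "HC_class A 0 \<phi> = HC_class A 0 \<psi>" "x \<in> carrier A"
  shows "\<phi> [x] = \<psi> [x]"
proof -
  have "\<phi> \<in> HC_class A 0 \<phi>" using assms(1) by (simp add: HC_class_def cyclic_coboundary_def)
  then have "cyclic_coboundary A 0 (\<lambda>as. \<phi> as - \<psi> as)"
    unfolding assms(2) by (simp add: HC_class_def)
  then show ?thesis using assms(3) by (simp add: cyclic_coboundary_def arg_lists_def)
qed

theorem mainTheorem1:
  fixes q :: real
    and \<Delta> :: "suq2 \<Rightarrow> (suq2 \<times> suq2 \<Rightarrow>\<^sub>0 complex) set"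
    and \<tau>_ev :: "suq2 \<Rightarrow> complex"
  assumes "0 < q" and "q < 1"
    and "is_SUq2_coproduct q \<Delta>"
    and "trace_functional (SUq2 q) \<tau>_ev"
    and "\<tau>_ev \<one>\<^bsub>SUq2 q\<^esub> = 1"
    and "\<exists>g. K0_generator (SUq2 q) g \<and>
             chern_character_of (SUq2 q) (HC_class (SUq2 q) 0 (cochain0 \<tau>_ev)) g"
  shows "\<not> invariant_class (SUq2 q) \<Delta> 0 (HC_class (SUq2 q) 0 (cochain0 \<tau>_ev))"
proof
  assume "invariant_class (SUq2 q) \<Delta> 0 (HC_class (SUq2 q) 0 (cochain0 \<tau>_ev))"
  then obtain \<phi> where inv: "invariant_functional (SUq2 q) \<Delta> 1 \<phi>"
    and "cyclic_cocycle (SUq2 q) 0 \<phi>"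
    and "HC_class (SUq2 q) 0 \<phi> = HC_class (SUq2 q) 0 (cochain0 \<tau>_ev)"
    by (auto simp: invariant_class_def)
  then have \<phi>: "\<phi> [suq2_word q w] = \<tau>_ev (suq2_word q w)" for w
    using HC_class_zero_eqD[of "SUq2 q" \<phi> "cochain0 \<tau>_ev"] by (simp add: cochain0_def)
  obtain \<psi> where \<psi>: "linear_functional (SUq2 q) \<psi>" "\<psi> (suq2_word q [Lb, Lbs]) = 1"
    using exists_functional_beta by blast
  have "multilinear (SUq2 q) 1 \<phi>" using inv by (simp add: invariant_functional_def)
  \<comment> \<open>Of the four terms of the decomposition only the last survives the values of the
    trace. Its first leg \<open>\<alpha>\<^sup>*\<alpha>\<close> has trace \<open>1\<close>, and
    \<open>\<psi>\<close> is \<open>1\<close> on its second leg.\<close>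
  then have "convolution (SUq2 q) \<Delta> \<phi> \<psi> [suq2_word q [Lb, Lbs]] = 1"
    using trace_word_values[OF assms(4,1,2)] assms(5) \<psi>
    by (subst convolution_one_argument[where \<Delta> = \<Delta> and a = "suq2_word q [Lb, Lbs]",
          OF SUq2_complex_algebra _ _ _ coproduct_beta_beta_star[OF assms(3)]]) (simp_all add: \<phi>)
  \<comment> \<open>Invariance makes the same number \<open>\<psi>(1)\<close> times the trace of
    \<open>\<beta>\<beta>\<^sup>*\<close>, which is \<open>0\<close>.\<close>
  moreover have "convolution (SUq2 q) \<Delta> \<phi> \<psi> [suq2_word q [Lb, Lbs]] =
      \<psi> \<one>\<^bsub>SUq2 q\<^esub> * \<phi> [suq2_word q [Lb, Lbs]]"
    using inv \<psi>(1) by (simp add: invariant_functional_def arg_lists_def)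
  ultimately show False
    using trace_word_values(1)[OF assms(4,1,2)] by (simp add: \<phi>)
qed

end
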